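(* Let $\alpha$ be a simple root and $w\in W$. If $w r_\alpha > w$, then $S_w\cdot r_\alpha = S_w$. Otherwise (i.e. if $wr_\alpha<w$), $$ S_w \cdot r_\alpha = S_w - (w\cdot \alpha)\, S_{wr_\alpha} - \sum_{\substack{\beta\in\Delta_+:\\ w'=wr_\alpha r_\beta \text{ covers } wr_\alpha}} \langle \alpha,\beta \rangle\, S_{w'} . $$
   Context: Let $G$ be a connected complex semisimple Lie group of adjoint type, with opposite Borel subgroups $B,B_-$, maximal torus $T^{\mathbb C}=B\cap B_-$ with maximal compact subtorus $T$, set of roots $\Delta$, positive roots $\Delta_+$, and Weyl group $W$. For $\beta\in\Delta$, $r_\beta\in W$ is the corresponding reflection. Let $l$ be the length function on $W$ and $\geq$ the (strong) Bruhat order; $w'$ covers $w$ if $w'>w$ and $l(w')=l(w)+1$. Let $H=H^*_T(pt)$, the polynomial ring over $\mathbb Z$ in the simple roots (each simple root has degree $2$), with its natural action of $W$; every root is regarded as an element of $H$. For roots $\alpha,\beta$, put $\langle\alpha,\beta\rangle:=(\alpha-r_\beta\alpha)/\beta\in\mathbb Z$. Combinatorial model of $H^*_T(G/B)$: a class $p$ is a list $\{p|_w\}_{w\in W}$ of elements of $H$ satisfying the GKM conditions: $p|_v-p|_{r_\beta v}$ is a multiple of $\beta$ in $H$ for all $v\in W$, $\beta\in\Delta$. Classes form an $H$-algebra under pointwise operations, identified with $H^*_T(G/B)$ by restriction to $T$-fixed points. The equivariant Schubert class $S_w$ (the class of $X_w=\overline{B_-wB}$) is the unique class that is homogeneous of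 degree $2l(w)$ (i.e. polynomial degree $l(w)$), satisfies $S_w|_v=0$ whenever $l(v)\le l(w)$ and $v\ne w$, and has $S_w|_w=\prod_{\beta\in\Delta_+,\ r_\beta w<w}\beta$. It satisfies $S_w|_v=0$ unless $v\geq w$, and $\{S_w\}_{w\in W}$ is an $H$-basis of the ring of classes. For a class $p$ and a simple root $\alpha$, $p\cdot r_\alpha$ is the class given by $(p\cdot r_\alpha)|_v:=p|_{vr_\alpha}$. *)

theory Defs
  imports "HOL-Analysis.Analysis" "HOL-Library.Poly_Mapping"
begin

text \<open>
  The combinatorial data of a semisimple group of adjoint type: a reduced crystallographic root
  system \<open>\<Delta>\<close> spanning a Euclidean space, together with a base. The choice of the pair of opposite
  Borel subgroups is the choice of the base.
\<close>

definition root_refl :: "'v::euclidean_space \<Rightarrow> 'v \<Rightarrow> 'v" where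
  "root_refl \<beta> x = x - (2 * (x \<bullet> \<beta>) / (\<beta> \<bullet> \<beta>)) *\<^sub>R \<beta>"

definition root_system :: "'v::euclidean_space set \<Rightarrow> bool" where
  "root_system \<Delta> \<longleftrightarrow>
     finite \<Delta> \<and> 0 \<notin> \<Delta> \<and> span \<Delta> = UNIV \<and>
     (\<forall>\<alpha>\<in>\<Delta>. \<forall>\<beta>\<in>\<Delta>. root_refl \<beta> \<alpha> \<in> \<Delta>) \<and>
     (\<forall>\<alpha>\<in>\<Delta>. \<forall>\<beta>\<in>\<Delta>. 2 * (\<alpha> \<bullet> \<beta>) / (\<beta> \<bullet> \<beta>) \<in> \<int>) \<and>
     (\<forall>\<beta>\<in>\<Delta>. \<forall>c. c *\<^sub>R \<beta> \<in> \<Delta> \<longrightarrow> c = 1 \<or> c = -1)"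

text \<open>
  The simple roots are a family \<open>\<sigma>\<close> indexed by a finite type (the nodes of the Dynkin diagram),
  so that the rank is \<open>CARD('i)\<close>.
\<close>

definition simple_system :: "'v::euclidean_space set \<Rightarrow> ('i::finite \<Rightarrow> 'v) \<Rightarrow> bool" where
  "simple_system \<Delta> \<sigma> \<longleftrightarrow>
     inj \<sigma> \<and> independent (range \<sigma>) \<and> range \<sigma> \<subseteq> \<Delta> \<and>
     (\<forall>\<beta>\<in>\<Delta>. \<exists>c :: 'i \<Rightarrow> nat.
        \<beta> = (\<Sum>i\<in>UNIV. real (c i) *\<^sub>R \<sigma> i) \<or> \<beta> = - (\<Sum>i\<in>UNIV. real (c i) *\<^sub>R \<sigma> i))"

definition pos_roots :: "'v::euclidean_space set \<Rightarrow> ('i::finite \<Rightarrow> 'v) \<Rightarrow> 'v set" where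
  "pos_roots \<Delta> \<sigma> = {\<beta> \<in> \<Delta>. \<exists>c :: 'i \<Rightarrow> nat. \<beta> = (\<Sum>i\<in>UNIV. real (c i) *\<^sub>R \<sigma> i)}"

definition pairing :: "'v::euclidean_space \<Rightarrow> 'v \<Rightarrow> int" where
  "pairing \<alpha> \<beta> = (THE n. \<alpha> - root_refl \<beta> \<alpha> = real_of_int n *\<^sub>R \<beta>)"

inductive_set weyl :: "'v::euclidean_space set \<Rightarrow> ('v \<Rightarrow> 'v) set" for \<Delta> where
  weyl_id: "id \<in> weyl \<Delta>"
| weyl_refl: "w \<in> weyl \<Delta> \<Longrightarrow> \<beta> \<in> \<Delta> \<Longrightarrow> root_refl \<beta> \<circ> w \<in> weyl \<Delta>"

definition word :: "('i \<Rightarrow> 'v::euclidean_space) \<Rightarrow> 'i list \<Rightarrow> 'v \<Rightarrow> 'v" where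
  "word \<sigma> is = foldr (\<lambda>i f. root_refl (\<sigma> i) \<circ> f) is id"

definition len :: "('i \<Rightarrow> 'v::euclidean_space) \<Rightarrow> ('v \<Rightarrow> 'v) \<Rightarrow> nat" where
  "len \<sigma> w = (LEAST k. \<exists>is. length is = k \<and> word \<sigma> is = w)"

definition bruhat_le ::
    "'v::euclidean_space set \<Rightarrow> ('i \<Rightarrow> 'v) \<Rightarrow> ('v \<Rightarrow> 'v) \<Rightarrow> ('v \<Rightarrow> 'v) \<Rightarrow> bool" where
  "bruhat_le \<Delta> \<sigma> =
     (\<lambda>u v. u \<in> weyl \<Delta> \<and> (\<exists>\<beta>\<in>\<Delta>. v = root_refl \<beta> \<circ> u) \<and> len \<sigma> u < len \<sigma> v)\<^sup>*\<^sup>*"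

definition bruhat_less ::
    "'v::euclidean_space set \<Rightarrow> ('i \<Rightarrow> 'v) \<Rightarrow> ('v \<Rightarrow> 'v) \<Rightarrow> ('v \<Rightarrow> 'v) \<Rightarrow> bool" where
  "bruhat_less \<Delta> \<sigma> u v \<longleftrightarrow> bruhat_le \<Delta> \<sigma> u v \<and> u \<noteq> v"

definition covers ::
    "'v::euclidean_space set \<Rightarrow> ('i \<Rightarrow> 'v) \<Rightarrow> ('v \<Rightarrow> 'v) \<Rightarrow> ('v \<Rightarrow> 'v) \<Rightarrow> bool" where
  "covers \<Delta> \<sigma> w' w \<longleftrightarrow> bruhat_less \<Delta> \<sigma> w w' \<and> len \<sigma> w' = len \<sigma> w + 1"

text \<open>
  \<open>H\<close> is the polynomial ring over the integers with one variable \<open>X\<^sub>i\<close> for each simple root: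
  finitely supported functions from monomials (exponent vectors) to coefficients.
\<close>

type_synonym 'i H = "('i \<Rightarrow>\<^sub>0 nat) \<Rightarrow>\<^sub>0 int"

text \<open>An element of the root lattice as a linear form in \<open>H\<close>; the simple root \<open>\<sigma> i\<close> becomes \<open>X\<^sub>i\<close>.\<close>

definition root_coeff :: "('i::finite \<Rightarrow> 'v::euclidean_space) \<Rightarrow> 'v \<Rightarrow> 'i \<Rightarrow> int" where
  "root_coeff \<sigma> x = (THE c. x = (\<Sum>i\<in>UNIV. real_of_int (c i) *\<^sub>R \<sigma> i))"

definition root_H :: "('i::finite \<Rightarrow> 'v::euclidean_space) \<Rightarrow> 'v \<Rightarrow> 'i H" where
  "root_H \<sigma> x =
     (\<Sum>i\<in>UNIV. Poly_Mapping.single (Poly_Mapping.single i 1) (root_coeff \<sigma> x i))"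

text \<open>The action of \<open>w\<close> on \<open>H\<close>: the ring endomorphism sending \<open>X\<^sub>i\<close> to the linear form of \<open>w (\<sigma> i)\<close>.\<close>

definition act_H :: "('i::finite \<Rightarrow> 'v::euclidean_space) \<Rightarrow> ('v \<Rightarrow> 'v) \<Rightarrow> 'i H \<Rightarrow> 'i H" where
  "act_H \<sigma> w f =
     (\<Sum>m\<in>Poly_Mapping.keys f. of_int (Poly_Mapping.lookup f m) *
        (\<Prod>i\<in>UNIV. root_H \<sigma> (w (\<sigma> i)) ^ Poly_Mapping.lookup m i))"

text \<open>Homogeneity for the cohomological grading, in which every variable has degree 2.\<close>

definition homogeneous :: "nat \<Rightarrow> ('i::finite) H \<Rightarrow> bool" where
  "homogeneous d f \<longleftrightarrow>
     (\<forall>m\<in>Poly_Mapping.keys f. (\<Sum>i\<in>UNIV. 2 * Poly_Mapping.lookup m i) = d)"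

text \<open>
  A class is a family indexed by \<open>W\<close>. It is represented by a function on all maps of the ambient
  space, extended by \<open>0\<close> outside \<open>W\<close>, so that equality of functions is equality of classes.
\<close>

definition gkm_class ::
    "'v::euclidean_space set \<Rightarrow> ('i::finite \<Rightarrow> 'v) \<Rightarrow> (('v \<Rightarrow> 'v) \<Rightarrow> 'i H) \<Rightarrow> bool" where
  "gkm_class \<Delta> \<sigma> p \<longleftrightarrow>
     (\<forall>v. v \<notin> weyl \<Delta> \<longrightarrow> p v = 0) \<and>
     (\<forall>v\<in>weyl \<Delta>. \<forall>\<beta>\<in>\<Delta>. root_H \<sigma> \<beta> dvd p v - p (root_refl \<beta> \<circ> v))"

definition is_schubert ::
    "'v::euclidean_space set \<Rightarrow> ('i::finite \<Rightarrow> 'v) \<Rightarrow> ('v \<Rightarrow> 'v) \<Rightarrow> (('v \<Rightarrow> 'v) \<Rightarrow> 'i H) \<Rightarrow> bool" where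
  "is_schubert \<Delta> \<sigma> w p \<longleftrightarrow>
     gkm_class \<Delta> \<sigma> p \<and>
     (\<forall>v\<in>weyl \<Delta>. homogeneous (2 * len \<sigma> w) (p v)) \<and>
     (\<forall>v\<in>weyl \<Delta>. len \<sigma> v \<le> len \<sigma> w \<and> v \<noteq> w \<longrightarrow> p v = 0) \<and>
     p w = (\<Prod>\<beta>\<in>{\<beta> \<in> pos_roots \<Delta> \<sigma>. bruhat_less \<Delta> \<sigma> (root_refl \<beta> \<circ> w) w}. root_H \<sigma> \<beta>)"

definition schubert ::
    "'v::euclidean_space set \<Rightarrow> ('i::finite \<Rightarrow> 'v) \<Rightarrow> ('v \<Rightarrow> 'v) \<Rightarrow> ('v \<Rightarrow> 'v) \<Rightarrow> 'i H" where
  "schubert \<Delta> \<sigma> w = (THE p. is_schubert \<Delta> \<sigma> w p)"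

definition right_act ::
    "(('v::euclidean_space \<Rightarrow> 'v) \<Rightarrow> 'i H) \<Rightarrow> 'v \<Rightarrow> ('v \<Rightarrow> 'v) \<Rightarrow> 'i H" where
  "right_act p \<alpha> v = p (v \<circ> root_refl \<alpha>)"

end

theory Submission
  imports Defs
begin

text \<open>
  A homogeneous class of degree \<open>d\<close> that vanishes at all elements of length at most \<open>d\<close> is zero: at an
  element \<open>v\<close> of minimal length in its support it is divisible by the \<open>l(v) > d\<close> positive roots \<open>\<beta>\<close>
  with \<open>r\<^sub>\<beta>v < v\<close>, which are pairwise coprime in \<open>H\<close>. This gives uniqueness of Schubert classes;
  they exist because the divided difference
  \<open>v \<mapsto> (p|\<^bsub>vr\<^esub> - p|\<^sub>v) / v\<alpha>\<close> maps \<open>S\<^bsub>ur\<^esub>\<close> to \<open>S\<^sub>u\<close> whenever \<open>ur > u\<close>.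
  At an ascent the divided difference of \<open>S\<^sub>w\<close> vanishes by the same degree argument. At a descent
  \<open>w = ur\<close> it is \<open>S\<^sub>u\<close>, so \<open>S\<^sub>w\<cdot>r = S\<^sub>w + (v\<alpha>) S\<^sub>u\<close>, and
  \<open>(v\<alpha> - u\<alpha>) S\<^sub>u = - \<Sum> \<langle>\<alpha>,\<beta>\<rangle> S\<^sub>w\<^sub>'\<close> follows by comparing values at the covers of \<open>u\<close>.
\<close>

section \<open>Polynomials\<close>

text \<open>Coefficients are integers, so a linear form could a priori be a multiple of a prime
  number, and dividing by several roots in turn would then fail. Adjoint type excludes this: the
  variables of H are the simple roots, every root lies in the Weyl orbit of one of them, and so an
  automorphism of H turns any given root into a variable, which is a prime element. The comparison
  at covers rests on one value. For a cover v = r_\<delta> u of u, the value of S_v at v is \<delta>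
  times the value of S_u at v. Divisibility and degree determine the latter only up to an integer
  factor; that the factor is 1 is read off modulo \<delta>, from the effect of deleting one letter
  in a reduced word of v.\<close>

lemma of_int_mult_frag:
  "(of_int c :: ('a::comm_monoid_add) \<Rightarrow>\<^sub>0 int) * x = frag_cmul c x"
proof (induction c rule: int_induct[where k=0])
  case base
  then show ?case by simp
next
  case (step1 i)
  then show ?case by (simp add: distrib_right frag_cmul_distrib)
next
  case (step2 i)
  have "frag_cmul (i - 1) x = frag_cmul i x - x"
    using frag_cmul_distrib[of "i - 1" 1 x] by simp
  then show ?case using step2 by (simp add: left_diff_distrib)
qed

text \<open>Evaluation of the variables, a ring homomorphism. H is the free abelian group on the
  monomials, so \<open>frag_extend\<close> provides additivity, and the identities below need
  checking on monomials only, through \<open>frag_induct\<close>. The Weyl group action is the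
  instance in \<open>act_H_subst\<close>.\<close>

definition subst :: "('i::finite \<Rightarrow> 'j H) \<Rightarrow> 'i H \<Rightarrow> 'j H" where
  "subst \<phi> = frag_extend (\<lambda>m. \<Prod>i\<in>UNIV. \<phi> i ^ Poly_Mapping.lookup m i)"

definition var :: "'i \<Rightarrow> 'i H" where
  "var i = frag_of (Poly_Mapping.single i 1)"

lemma subst_0 [simp]: "subst \<phi> 0 = 0"
  by (simp add: subst_def)

lemma subst_diff: "subst \<phi> (f - g) = subst \<phi> f - subst \<phi> g"
  by (simp add: subst_def frag_extend_diff)

lemma subst_sum: "finite I \<Longrightarrow> subst \<phi> (sum f I) = (\<Sum>i\<in>I. subst \<phi> (f i))"
  by (simp add: subst_def frag_extend_sum)

lemma subst_cmul: "subst \<phi> (frag_cmul c f) = frag_cmul c (subst \<phi> f)"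
  by (simp add: subst_def frag_extend_cmul)

lemma frag_induct:
  assumes "P 0" "\<And>x. P (frag_of x)" "\<And>a b. P a \<Longrightarrow> P b \<Longrightarrow> P (a - b)"
  shows "P f"
  by (rule frag_induction[of f UNIV P]) (use assms in auto)

lemma frag_of_mult: "frag_of (m::'a::monoid_add) * frag_of n = frag_of (m + n)"
  by (simp add: mult_single)

lemma frag_of_0: "frag_of 0 = 1"
  by simp

lemma subst_mult: "subst \<phi> (f * g) = subst \<phi> f * subst \<phi> g"
proof (induction f rule: frag_induct)
  case (2 m)
  show ?case
  proof (induction g rule: frag_induct)
    case (2 n)
    then show ?case
      by (simp add: subst_def frag_of_mult lookup_add power_add prod.distrib)
  qed (simp_all add: subst_diff right_diff_distrib)
qed (simp_all add: subst_diff left_diff_distrib)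

lemma subst_1: "subst \<phi> 1 = 1"
  unfolding frag_of_0[symmetric] subst_def frag_extend_of by simp

lemma subst_power: "subst \<phi> (f ^ n) = subst \<phi> f ^ n"
  by (induction n) (simp_all add: subst_1 subst_mult)

lemma subst_prod: "subst \<phi> (prod f I) = (\<Prod>i\<in>I. subst \<phi> (f i))"
  by (induction I rule: infinite_finite_induct) (simp_all add: subst_1 subst_mult)

lemma subst_var [simp]: "subst \<phi> (var i) = \<phi> i"
proof -
  have "(\<Prod>j\<in>UNIV. \<phi> j ^ Poly_Mapping.lookup (Poly_Mapping.single i (1::nat)) j)
      = (\<Prod>j\<in>UNIV. if j = i then \<phi> j else 1)"
    by (intro prod.cong) (auto simp: lookup_single)
  then show ?thesis by (simp add: subst_def var_def)
qed

lemma var_power: "frag_of (Poly_Mapping.single i n) = var i ^ n"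
proof (induction n)
  case (Suc n)
  have "frag_of (Poly_Mapping.single i (Suc n))
      = var i * frag_of (Poly_Mapping.single i n)"
    by (simp add: var_def frag_of_mult flip: single_add)
  then show ?case using Suc by simp
qed simp

lemma prod_frag_of:
  "finite A \<Longrightarrow> (\<Prod>i\<in>A. frag_of (m i)) = frag_of (\<Sum>i\<in>A. m i :: 'a::comm_monoid_add)"
  by (induction A rule: finite_induct) (simp_all add: frag_of_mult)

lemma monom_prod_var:
  "(\<Prod>i\<in>UNIV. var (n i) ^ Poly_Mapping.lookup m i)
    = frag_of (\<Sum>i\<in>UNIV. Poly_Mapping.single (n i) (Poly_Mapping.lookup m i))"
  for m :: "'i::finite \<Rightarrow>\<^sub>0 nat"
  by (simp only: var_power[symmetric] prod_frag_of[OF finite])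

lemma poly_mapping_sum_single:
  "(\<Sum>i\<in>UNIV. Poly_Mapping.single i (Poly_Mapping.lookup m i)) = m"
  for m :: "'i::finite \<Rightarrow>\<^sub>0 nat"
  by (rule poly_mapping_eqI) (simp add: lookup_sum lookup_single when_def)

lemma subst_id [simp]: "subst var f = f"
proof (induction f rule: frag_induct)
  case (2 m)
  then show ?case
    by (simp only: subst_def frag_extend_of monom_prod_var poly_mapping_sum_single)
qed (simp_all add: subst_diff)

lemma subst_subst: "subst \<phi> (subst \<psi> f) = subst (\<lambda>i. subst \<phi> (\<psi> i)) f"
proof (induction f rule: frag_induct)
  case (2 m)
  have "subst \<phi> (subst \<psi> (frag_of m)) = (\<Prod>i\<in>UNIV. subst \<phi> (\<psi> i) ^ Poly_Mapping.lookup m i)"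
    by (simp add: subst_def[of \<psi>] subst_prod subst_power)
  then show ?case by (simp add: subst_def)
qed (simp_all add: subst_diff)

section \<open>Congruences between values of polynomials\<close>

lemma prod_diff_dvd:
  fixes f g :: "'a \<Rightarrow> 'b::comm_ring_1"
  assumes "\<And>i. i \<in> A \<Longrightarrow> d dvd f i - g i"
  shows "d dvd prod f A - prod g A"
  using assms
proof (induction A rule: infinite_finite_induct)
  case (insert x A)
  have "prod f (insert x A) - prod g (insert x A)
      = (f x - g x) * prod f A + g x * (prod f A - prod g A)"
    using insert by (simp add: algebra_simps)
  then show ?case using insert by (auto intro!: dvd_add dvd_mult dvd_mult2)
qed auto

lemma prod_list_diff_dvd:
  fixes f g :: "'a \<Rightarrow> 'b::comm_ring_1"
  assumes "\<And>x. x \<in> set xs \<Longrightarrow> d dvd f x - g x"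
  shows "d dvd prod_list (map f xs) - prod_list (map g xs)"
  using assms
proof (induction xs)
  case (Cons x xs)
  have "prod_list (map f (x # xs)) - prod_list (map g (x # xs))
      = (f x - g x) * prod_list (map f xs) + g x * (prod_list (map f xs) - prod_list (map g xs))"
    by (simp add: algebra_simps)
  then show ?case using Cons by (auto intro!: dvd_add dvd_mult dvd_mult2)
qed simp

lemma power_diff_dvd:
  fixes x y :: "'b::comm_ring_1"
  assumes "d dvd x - y"
  shows "d dvd x ^ n - y ^ n"
  using prod_diff_dvd[of "{..<n}" d "\<lambda>_. x" "\<lambda>_. y"] assms by simp

lemma subst_cong_dvd:
  assumes "\<And>i. d dvd \<phi> i - \<psi> i"
  shows "d dvd subst \<phi> f - subst \<psi> f"
proof (induction f rule: frag_induct)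
  case (2 m)
  then show ?case
    by (simp add: subst_def prod_diff_dvd power_diff_dvd assms)
next
  case (3 a b)
  have "subst \<phi> (a - b) - subst \<psi> (a - b) = (subst \<phi> a - subst \<psi> a) - (subst \<phi> b - subst \<psi> b)"
    by (simp add: subst_diff algebra_simps)
  then show ?case using 3 by (metis dvd_diff)
qed simp

text \<open>The library makes \<open>H\<close> an integral domain only for linearly ordered variables.\<close>

lemma H_no_zero_divisors:
  fixes f g :: "'i::finite H"
  assumes "f * g = 0"
  shows "f = 0 \<or> g = 0"
proof -
  obtain n :: "'i \<Rightarrow> nat" where n: "inj n"
    using finite_imp_inj_to_nat_seg[OF finite[of "UNIV :: 'i set"]] by blast
  define E where "E m = (\<Sum>i\<in>UNIV. Poly_Mapping.single (n i) (Poly_Mapping.lookup m i))"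
    for m :: "'i \<Rightarrow>\<^sub>0 nat"
  have E: "Poly_Mapping.lookup (E m) (n i) = Poly_Mapping.lookup m i" for m i
    using n by (simp add: E_def lookup_sum lookup_single when_def inj_eq)
  have injE: "E m = E m' \<longleftrightarrow> m = m'" for m m'
    by (metis E poly_mapping_eqI)
  \<comment> \<open>Renaming the variables by natural numbers lands in a polynomial ring that is
    already known to be a domain. By \<open>lookup_h\<close> the coefficients can be recovered, so
    the renaming is injective.\<close>
  define h where "h = subst (\<lambda>i. var (n i))"
  have h: "h f = frag_extend (frag_of \<circ> E) f" for f
    by (simp only: h_def subst_def monom_prod_var E_def o_def)
  have lookup_h: "Poly_Mapping.lookup (h f) (E m) = Poly_Mapping.lookup f m" for f m
  proof (induction f rule: frag_induct)
    case (3 a b)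
    then show ?case by (simp add: h_def subst_diff lookup_minus)
  qed (simp_all add: h lookup_single injE)
  have "h f * h g = 0" using assms by (simp add: h_def flip: subst_mult)
  then have "h f = 0 \<or> h g = 0" by simp
  then show ?thesis using lookup_h by (metis lookup_zero poly_mapping_eqI)
qed

lemma H_mult_cancel:
  fixes f g h :: "'i::finite H"
  assumes "h * f = h * g" "h \<noteq> 0"
  shows "f = g"
  using H_no_zero_divisors[of h "f - g"] assms by (simp add: right_diff_distrib)

lemma H_prod_nonzero:
  fixes f :: "'a \<Rightarrow> 'i::finite H"
  assumes "\<And>x. x \<in> A \<Longrightarrow> f x \<noteq> 0"
  shows "prod f A \<noteq> 0"
  using assms by (induction A rule: infinite_finite_induct) (auto dest: H_no_zero_divisors)

section \<open>Degrees and homogeneous forms\<close>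

definition mdeg :: "('i::finite \<Rightarrow>\<^sub>0 nat) \<Rightarrow> nat" where
  "mdeg m = (\<Sum>i\<in>UNIV. 2 * Poly_Mapping.lookup m i)"

lemma mdeg_add: "mdeg (m + n) = mdeg m + mdeg n"
  by (simp add: mdeg_def lookup_add sum.distrib distrib_left)

lemma homogeneous_iff: "homogeneous d f \<longleftrightarrow> (\<forall>m\<in>Poly_Mapping.keys f. mdeg m = d)"
  by (simp add: homogeneous_def mdeg_def)

lemma homogeneous_0 [simp]: "homogeneous d 0"
  by (simp add: homogeneous_iff)

lemma homogeneous_1: "homogeneous 0 1"
  by (simp add: homogeneous_iff mdeg_def)

lemma homogeneous_var: "homogeneous 2 (var i)"
  by (simp add: var_def homogeneous_iff mdeg_def lookup_single when_def sum_distrib_left[symmetric])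

lemma homogeneous_add:
  "homogeneous d f \<Longrightarrow> homogeneous d g \<Longrightarrow> homogeneous d (f + g)"
  unfolding homogeneous_iff using keys_add[of f g] by blast

lemma homogeneous_diff:
  "homogeneous d f \<Longrightarrow> homogeneous d g \<Longrightarrow> homogeneous d (f - g)"
  unfolding homogeneous_iff using keys_diff[of f g] by blast

lemma homogeneous_sum:
  "(\<And>x. x \<in> A \<Longrightarrow> homogeneous d (f x)) \<Longrightarrow> homogeneous d (sum f A)"
  by (induction A rule: infinite_finite_induct) (simp_all add: homogeneous_add)

lemma homogeneous_mult:
  "homogeneous d f \<Longrightarrow> homogeneous e g \<Longrightarrow> homogeneous (d + e) (f * g)"
  unfolding homogeneous_iff using keys_mult[of f g] by (fastforce simp: mdeg_add)

lemma homogeneous_of_int_mult: "homogeneous d f \<Longrightarrow> homogeneous d (of_int c * f)"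
  unfolding homogeneous_iff of_int_mult_frag using keys_cmul[of c f] by blast

lemma homogeneous_prod:
  assumes "finite A" "\<And>x. x \<in> A \<Longrightarrow> homogeneous 2 (f x)"
  shows "homogeneous (2 * card A) (prod f A)"
  using assms
proof (induction A rule: finite_induct)
  case (insert x A)
  then show ?case using homogeneous_mult[of 2 "f x" "2 * card A" "prod f A"] by simp
qed (simp add: homogeneous_1)

text \<open>The part \<open>c\<close> of g in the degree of \<open>m\<close> is nonzero and H is a
  domain, so f * c has a monomial, of degree a + mdeg m. No monomial of f * (g - c) has that degree,
  hence this one survives in f * g and its degree is d.\<close>

lemma homogeneous_factor_deg:
  fixes f g :: "'i::finite H"
  assumes f: "homogeneous a f" "f \<noteq> 0" and fg: "homogeneous d (f * g)"
    and m: "m \<in> Poly_Mapping.keys g"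
  shows "a + mdeg m = d"
proof -
  define c where "c = Poly_Mapping.mapp (\<lambda>k x. if mdeg k = mdeg m then x else 0) g"
  have c: "Poly_Mapping.lookup c k = (if mdeg k = mdeg m then Poly_Mapping.lookup g k else 0)" for k
    by (simp add: c_def lookup_mapp when_def in_keys_iff)
  have "Poly_Mapping.lookup c m \<noteq> 0" using m by (simp add: c in_keys_iff)
  then have "c \<noteq> 0" by auto
  then have "f * c \<noteq> 0" using H_no_zero_divisors f(2) by blast
  then obtain k where k: "k \<in> Poly_Mapping.keys (f * c)"
    using keys_eq_empty by blast
  have "homogeneous (mdeg m) c" by (auto simp: homogeneous_iff in_keys_iff c split: if_splits)
  then have degk: "mdeg k = a + mdeg m" using homogeneous_mult[OF f(1)] k by (auto simp: homogeneous_iff)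
  have "k \<notin> Poly_Mapping.keys (f * (g - c))"
  proof
    assume "k \<in> Poly_Mapping.keys (f * (g - c))"
    then obtain x y where xy: "k = x + y" "x \<in> Poly_Mapping.keys f" "y \<in> Poly_Mapping.keys (g - c)"
      using keys_mult by blast
    have "mdeg y \<noteq> mdeg m" using xy(3) by (auto simp: in_keys_iff lookup_minus c)
    then show False using degk xy f(1) by (auto simp: mdeg_add homogeneous_iff)
  qed
  moreover have "f * g = f * c + f * (g - c)" by (simp add: algebra_simps)
  ultimately have "k \<in> Poly_Mapping.keys (f * g)"
    using k by (simp add: in_keys_iff lookup_add)
  then show ?thesis using fg degk by (simp add: homogeneous_iff)
qed

lemma homogeneous_factor:
  fixes f g :: "'i::finite H"
  assumes "homogeneous a f" "f \<noteq> 0" "homogeneous (a + d) (f * g)"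
  shows "homogeneous d g"
  using homogeneous_factor_deg[OF assms] by (auto simp: homogeneous_iff)

lemma homogeneous_dvd_eq_0:
  fixes f g :: "'i::finite H"
  assumes "homogeneous a f" "f \<noteq> 0" "homogeneous d g" "f dvd g" "d < a"
  shows "g = 0"
proof -
  obtain h where "g = f * h" using assms(4) by blast
  moreover from this have "h = 0"
    using homogeneous_factor_deg[OF assms(1,2), of d h] assms(3,5) keys_eq_empty[of h] by fastforce
  ultimately show ?thesis by simp
qed

section \<open>Coprimality of linear forms\<close>

lemma coprime_strip_prod:
  fixes l :: "'a \<Rightarrow> 'b::comm_ring_1"
  assumes "finite A" "\<And>y h. y \<in> A \<Longrightarrow> d dvd l y * h \<Longrightarrow> d dvd h" "d dvd prod l A * f"
  shows "d dvd f"
  using assms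
proof (induction A rule: finite_induct)
  case (insert y A)
  have "d dvd l y * (prod l A * f)" using insert.prems(2) insert.hyps by (simp add: mult.assoc)
  then have "d dvd prod l A * f" using insert.prems(1) by blast
  then show ?case using insert by blast
qed simp

text \<open>Coprimality is phrased as a cancellation property in place of gcds. If f = prod l A * q,
  then stripping the factors of A one by one from l x dvd f leaves l x dvd q.\<close>

lemma pairwise_coprime_prod_dvd:
  fixes l :: "'a \<Rightarrow> 'b::comm_ring_1"
  assumes "finite A" "\<And>x. x \<in> A \<Longrightarrow> l x dvd f"
    and coprime: "\<And>x y h. x \<in> A \<Longrightarrow> y \<in> A \<Longrightarrow> x \<noteq> y \<Longrightarrow> l x dvd l y * h \<Longrightarrow> l x dvd h"
  shows "prod l A dvd f"
  using assms
proof (induction A rule: finite_induct)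
  case (insert x A)
  have "prod l A dvd f" by (rule insert.IH) (use insert.prems in blast)+
  then obtain q where q: "f = prod l A * q" by blast
  have cop: "l x dvd h" if "y \<in> A" "x \<noteq> y" "l x dvd l y * h" for y and h
    using insert.prems(2)[of x y h] that by blast
  have "l x dvd q"
  proof (rule coprime_strip_prod[OF insert.hyps(1)])
    show "l x dvd h" if "y \<in> A" "l x dvd l y * h" for y and h
      using cop[OF that(1) _ that(2)] that(1) insert.hyps(2) by blast
    show "l x dvd prod l A * q" using insert.prems(1) q by simp
  qed
  then show ?case using q insert.hyps by (auto simp: mult.commute intro: mult_dvd_mono)
qed simp

lemma lookup_linear_form:
  "Poly_Mapping.lookup (\<Sum>j\<in>UNIV. frag_cmul (c j) (var j)) (Poly_Mapping.single i 1) = c i"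
  for c :: "'i::finite \<Rightarrow> int"
proof -
  have "Poly_Mapping.single j (1::nat) = Poly_Mapping.single i 1 \<longleftrightarrow> j = i" for j
    by (metis lookup_single_eq lookup_single_not_eq zero_neq_one)
  then have "Poly_Mapping.lookup (var j) (Poly_Mapping.single i 1) = (if j = i then 1 else 0)" for j
    unfolding var_def lookup_frag_of by metis
  then show ?thesis by (simp add: lookup_sum if_distrib[of "(*) _"] cong: if_cong)
qed

text \<open>Every polynomial is congruent modulo X_i to its restriction to X_i = 0, so the multiples
  of X_i are the kernel of this substitution.\<close>

lemma var_dvd_iff: "var i dvd f \<longleftrightarrow> subst (\<lambda>j. if j = i then 0 else var j) f = 0"
  (is "_ \<longleftrightarrow> subst ?\<pi> f = 0")
proof
  assume "subst ?\<pi> f = 0"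
  moreover have "var i dvd subst var f - subst ?\<pi> f"
    by (rule subst_cong_dvd) simp
  ultimately show "var i dvd f" by simp
next
  assume "var i dvd f"
  then obtain g where "f = var i * g" by blast
  then show "subst ?\<pi> f = 0" by (simp add: subst_mult)
qed

text \<open>At X_i = 0 the linear form keeps its nonzero coefficient \<open>c k\<close>. Since H is
  a domain, the product can vanish at X_i = 0 only if f does.\<close>

lemma var_dvd_linear_form_mult:
  fixes c :: "'i::finite \<Rightarrow> int"
  assumes "var i dvd (\<Sum>j\<in>UNIV. frag_cmul (c j) (var j)) * f" "k \<noteq> i" "c k \<noteq> 0"
  shows "var i dvd f"
proof -
  let ?\<pi> = "\<lambda>j. if j = i then 0 else var j"
  have "subst ?\<pi> (\<Sum>j\<in>UNIV. frag_cmul (c j) (var j))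
      = (\<Sum>j\<in>UNIV. frag_cmul ((c(i := 0)) j) (var j))"
    by (auto simp: subst_sum subst_cmul intro!: sum.cong)
  moreover have "\<dots> \<noteq> 0"
    using lookup_linear_form[of "c(i := 0)" k] assms(2,3) by (metis fun_upd_other lookup_zero)
  ultimately show ?thesis
    using assms(1) H_no_zero_divisors by (auto simp: var_dvd_iff subst_mult)
qed

section \<open>Root systems and length\<close>

lemma linear_root_refl: "linear (root_refl \<beta>)"
  by (rule linearI) (simp_all add: root_refl_def inner_add_left add_divide_distrib algebra_simps)

lemma root_refl_self: "\<beta> \<noteq> 0 \<Longrightarrow> root_refl \<beta> \<beta> = - \<beta>"
  by (simp add: root_refl_def scaleR_2)

lemma root_refl_uminus: "root_refl (- \<beta>) = root_refl \<beta>"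
  by (simp add: root_refl_def fun_eq_iff)

lemma root_refl_involutive [simp]: "root_refl \<beta> (root_refl \<beta> x) = x"
  by (cases "\<beta> = 0") (simp_all add: root_refl_def inner_diff_left algebra_simps)

lemma root_refl_comp_self [simp]: "root_refl \<beta> \<circ> root_refl \<beta> = id"
  by (simp add: fun_eq_iff)

lemma orthogonal_root_refl: "orthogonal_transformation (root_refl \<beta>)"
proof (cases "\<beta> = 0")
  case False
  have "root_refl \<beta> x \<bullet> root_refl \<beta> y = x \<bullet> y" for x y
  proof -
    define a b where "a = 2 * (x \<bullet> \<beta>) / (\<beta> \<bullet> \<beta>)" and "b = 2 * (y \<bullet> \<beta>) / (\<beta> \<bullet> \<beta>)"
    have ab: "a * (\<beta> \<bullet> \<beta>) = 2 * (x \<bullet> \<beta>)" "b * (\<beta> \<bullet> \<beta>) = 2 * (y \<bullet> \<beta>)"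
      using False by (simp_all add: a_def b_def)
    have "root_refl \<beta> x \<bullet> root_refl \<beta> y = x \<bullet> y - b * (x \<bullet> \<beta>) - a * (y \<bullet> \<beta>) + a * (b * (\<beta> \<bullet> \<beta>))"
      by (simp add: root_refl_def a_def[symmetric] b_def[symmetric] inner_diff_left inner_diff_right
          inner_commute[of \<beta> y] right_diff_distrib)
    also have "\<dots> = x \<bullet> y"
    proof -
      have "b * (x \<bullet> \<beta>) = a * (y \<bullet> \<beta>)" by (simp add: a_def b_def)
      then show ?thesis by (simp add: ab(2))
    qed
    finally show ?thesis .
  qed
  then show ?thesis by (simp add: orthogonal_transformation_def linear_root_refl)
next
  case True
  then show ?thesis
    using linear_root_refl[of \<beta>] by (auto simp: orthogonal_transformation_def) (simp add: root_refl_def)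
qed

lemma orthogonal_comp_root_refl:
  assumes "orthogonal_transformation w"
  shows "w \<circ> root_refl \<beta> = root_refl (w \<beta>) \<circ> w"
proof -
  have "linear w" "\<And>x y. w x \<bullet> w y = x \<bullet> y"
    using assms by (auto simp: orthogonal_transformation_def)
  then show ?thesis
    by (simp add: root_refl_def fun_eq_iff linear_diff linear_cmul)
qed

section \<open>Words in simple reflections, their length, and Bruhat order\<close>

lemma word_Nil [simp]: "word \<sigma> [] = id"
  by (simp add: word_def)

lemma word_Cons [simp]: "word \<sigma> (i # is) = root_refl (\<sigma> i) \<circ> word \<sigma> is"
  by (simp add: word_def)

lemma word_append: "word \<sigma> (xs @ ys) = word \<sigma> xs \<circ> word \<sigma> ys"
  by (induction xs) (simp_all add: comp_assoc)

lemma orthogonal_word: "orthogonal_transformation (word \<sigma> is)"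
proof (induction "is")
  case (Cons i "is")
  then show ?case
    unfolding word_Cons by (rule orthogonal_transformation_compose[OF orthogonal_root_refl])
qed (simp add: orthogonal_transformation_def linear_id[unfolded id_def] id_def)

lemma word_rev: "word \<sigma> is \<circ> word \<sigma> (rev is) = id"
proof (induction "is")
  case (Cons i "is")
  have "word \<sigma> (i # is) \<circ> word \<sigma> (rev (i # is))
      = root_refl (\<sigma> i) \<circ> (word \<sigma> is \<circ> word \<sigma> (rev is)) \<circ> root_refl (\<sigma> i)"
    by (simp add: word_append comp_assoc)
  then show ?case by (simp only: Cons comp_id root_refl_comp_self)
qed simp

text \<open>Conjugating a simple reflection by a word gives a palindromic word. This is how
  \<open>weyl_eq_words\<close> passes from all reflections to the simple ones.\<close>

lemma root_refl_word: "root_refl (word \<sigma> xs (\<sigma> i)) = word \<sigma> (xs @ i # rev xs)"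
proof -
  have "root_refl (word \<sigma> xs (\<sigma> i)) = root_refl (word \<sigma> xs (\<sigma> i)) \<circ> (word \<sigma> xs \<circ> word \<sigma> (rev xs))"
    by (simp only: word_rev comp_id)
  also have "\<dots> = word \<sigma> (xs @ i # rev xs)"
    by (simp add: word_append comp_assoc[symmetric] orthogonal_comp_root_refl[OF orthogonal_word])
  finally show ?thesis .
qed

lemma len_word_le: "len \<sigma> (word \<sigma> is) \<le> length is"
  unfolding len_def by (rule Least_le) blast

lemma reduced_word_exists: "\<exists>is. length is = len \<sigma> (word \<sigma> js) \<and> word \<sigma> is = word \<sigma> js"
  unfolding len_def by (rule LeastI_ex) blast

lemma bruhat_le_imp_len: "bruhat_le \<Delta> \<sigma> u v \<Longrightarrow> u = v \<or> len \<sigma> u < len \<sigma> v"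
  unfolding bruhat_le_def by (induction rule: rtranclp_induct) auto

text \<open>\<open>bruhat_le\<close> is a closure over chains, but length increases along each link.
  For two elements that differ by one reflection the order is therefore decided by length, and
  chains do not occur beyond this point.\<close>

lemma bruhat_less_root_refl_iff:
  assumes "u \<in> weyl \<Delta>" "\<beta> \<in> \<Delta>"
  shows "bruhat_less \<Delta> \<sigma> u (root_refl \<beta> \<circ> u) \<longleftrightarrow> len \<sigma> u < len \<sigma> (root_refl \<beta> \<circ> u)"
proof
  assume "bruhat_less \<Delta> \<sigma> u (root_refl \<beta> \<circ> u)"
  then show "len \<sigma> u < len \<sigma> (root_refl \<beta> \<circ> u)"
    using bruhat_le_imp_len unfolding bruhat_less_def by blast
next
  assume "len \<sigma> u < len \<sigma> (root_refl \<beta> \<circ> u)"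
  moreover from this have "bruhat_le \<Delta> \<sigma> u (root_refl \<beta> \<circ> u)"
    unfolding bruhat_le_def using assms by (intro r_into_rtranclp) blast
  ultimately show "bruhat_less \<Delta> \<sigma> u (root_refl \<beta> \<circ> u)"
    by (auto simp: bruhat_less_def)
qed

text \<open>The roots s_1 ... s_{j-1} applied to the j-th simple root of the word; for a reduced
  word these are its inversions (\<open>reduced_inversions\<close>). They are kept as a list so that
  a word and the same word with a letter deleted can be compared factor by factor.\<close>

fun invlist :: "('i \<Rightarrow> 'v::euclidean_space) \<Rightarrow> 'i list \<Rightarrow> 'v list" where
  "invlist \<sigma> [] = []"
| "invlist \<sigma> (i # is) = \<sigma> i # map (root_refl (\<sigma> i)) (invlist \<sigma> is)"

lemma length_invlist [simp]: "length (invlist \<sigma> is) = length is"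
  by (induction "is") simp_all

lemma invlist_append: "invlist \<sigma> (xs @ ys) = invlist \<sigma> xs @ map (word \<sigma> xs) (invlist \<sigma> ys)"
  by (induction xs) simp_all

locale based_root_system =
  fixes \<Delta> :: "'v::euclidean_space set" and \<sigma> :: "'i::finite \<Rightarrow> 'v"
  assumes root_system: "root_system \<Delta>" and simple_system: "simple_system \<Delta> \<sigma>"
begin

abbreviation \<Phi> :: "'v set" where "\<Phi> \<equiv> pos_roots \<Delta> \<sigma>"
abbreviation W :: "('v \<Rightarrow> 'v) set" where "W \<equiv> weyl \<Delta>"
abbreviation \<l> :: "('v \<Rightarrow> 'v) \<Rightarrow> nat" where "\<l> \<equiv> len \<sigma>"

section \<open>Positive roots, simple roots and height\<close>

lemma finite_roots: "finite \<Delta>"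
  and zero_not_root: "0 \<notin> \<Delta>"
  and root_refl_root: "\<alpha> \<in> \<Delta> \<Longrightarrow> \<beta> \<in> \<Delta> \<Longrightarrow> root_refl \<beta> \<alpha> \<in> \<Delta>"
  and root_integral: "\<alpha> \<in> \<Delta> \<Longrightarrow> \<beta> \<in> \<Delta> \<Longrightarrow> 2 * (\<alpha> \<bullet> \<beta>) / (\<beta> \<bullet> \<beta>) \<in> \<int>"
  and root_reduced: "\<beta> \<in> \<Delta> \<Longrightarrow> c *\<^sub>R \<beta> \<in> \<Delta> \<Longrightarrow> c = 1 \<or> c = -1"
  using root_system unfolding root_system_def by blast+

lemma root_nonzero: "\<beta> \<in> \<Delta> \<Longrightarrow> \<beta> \<noteq> 0"
  using zero_not_root by blast

lemma root_uminus: "\<beta> \<in> \<Delta> \<Longrightarrow> - \<beta> \<in> \<Delta>"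
  using root_refl_root[of \<beta> \<beta>] root_refl_self root_nonzero by metis

lemma inj_simple: "inj \<sigma>"
  and independent_simple: "independent (range \<sigma>)"
  and simple_root: "\<sigma> i \<in> \<Delta>"
  using simple_system unfolding simple_system_def by blast+

lemma simple_decomp:
  "\<beta> \<in> \<Delta> \<Longrightarrow> \<exists>c :: 'i \<Rightarrow> nat.
     \<beta> = (\<Sum>i\<in>UNIV. real (c i) *\<^sub>R \<sigma> i) \<or> \<beta> = - (\<Sum>i\<in>UNIV. real (c i) *\<^sub>R \<sigma> i)"
  using simple_system unfolding simple_system_def by blast

definition coord :: "'i \<Rightarrow> 'v \<Rightarrow> real" where
  "coord j = (SOME f. linear f \<and> (\<forall>i. f (\<sigma> i) = (if i = j then 1 else 0)))"

lemma linear_coord: "linear (coord j)"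
  and coord_simple: "coord j (\<sigma> i) = (if i = j then 1 else 0)"
proof -
  obtain g :: "'v \<Rightarrow> real" where "linear g"
    "\<forall>x\<in>range \<sigma>. g x = (if inv \<sigma> x = j then 1 else 0)"
    using linear_independent_extend[OF independent_simple, of "\<lambda>x. if inv \<sigma> x = j then 1 else 0"]
    by blast
  then have "linear g \<and> (\<forall>i. g (\<sigma> i) = (if i = j then 1 else 0))"
    using inj_simple by simp
  then have "linear (coord j) \<and> (\<forall>i. coord j (\<sigma> i) = (if i = j then 1 else 0))"
    unfolding coord_def
    by (rule someI[of "\<lambda>f. linear f \<and> (\<forall>i. f (\<sigma> i) = (if i = j then 1 else 0))"])
  then show "linear (coord j)" "coord j (\<sigma> i) = (if i = j then 1 else 0)"
    by blast+
qed

lemma coord_lincomb: "coord j (\<Sum>i\<in>UNIV. c i *\<^sub>R \<sigma> i) = c j"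
proof -
  have "coord j (\<Sum>i\<in>UNIV. c i *\<^sub>R \<sigma> i) = (\<Sum>i\<in>UNIV. c i * (if i = j then 1 else 0))"
    by (simp add: linear_sum[OF linear_coord] linear_cmul[OF linear_coord] coord_simple)
  then show ?thesis by (simp add: if_distrib[of "(*) _"] cong: if_cong)
qed

lemma coord_root_expand: "\<beta> \<in> \<Delta> \<Longrightarrow> \<beta> = (\<Sum>i\<in>UNIV. coord i \<beta> *\<^sub>R \<sigma> i)"
proof -
  assume "\<beta> \<in> \<Delta>"
  then obtain c :: "'i \<Rightarrow> nat" where
    "\<beta> = (\<Sum>i\<in>UNIV. real (c i) *\<^sub>R \<sigma> i) \<or> \<beta> = - (\<Sum>i\<in>UNIV. real (c i) *\<^sub>R \<sigma> i)"
    using simple_decomp by blast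
  then show ?thesis
    by (auto simp: coord_lincomb linear_neg[OF linear_coord] sum_negf)
qed

definition ht :: "'v \<Rightarrow> real" where "ht x = (\<Sum>j\<in>UNIV. coord j x)"

lemma linear_ht: "linear ht"
  unfolding ht_def by (intro linear_compose_sum ballI linear_coord)

lemma ht_simple: "ht (\<sigma> i) = 1"
  by (simp add: ht_def coord_simple)

lemma pos_root_coord_nonneg: "\<beta> \<in> \<Phi> \<Longrightarrow> 0 \<le> coord j \<beta>"
  by (auto simp: pos_roots_def coord_lincomb)

lemma pos_root_root: "\<beta> \<in> \<Phi> \<Longrightarrow> \<beta> \<in> \<Delta>"
  by (simp add: pos_roots_def)

lemma finite_pos_roots: "finite \<Phi>"
  using finite_roots by (simp add: pos_roots_def)

lemma pos_root_ht: "\<beta> \<in> \<Phi> \<Longrightarrow> 0 < ht \<beta>"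
proof -
  assume \<beta>: "\<beta> \<in> \<Phi>"
  have "ht \<beta> \<noteq> 0"
  proof
    assume "ht \<beta> = 0"
    then have "coord j \<beta> = 0" for j
      unfolding ht_def by (simp add: sum_nonneg_eq_0_iff pos_root_coord_nonneg[OF \<beta>])
    then have "\<beta> = 0" using coord_root_expand[OF pos_root_root[OF \<beta>]] by simp
    then show False using root_nonzero[OF pos_root_root[OF \<beta>]] by blast
  qed
  moreover have "0 \<le> ht \<beta>" unfolding ht_def by (simp add: sum_nonneg pos_root_coord_nonneg[OF \<beta>])
  ultimately show ?thesis by simp
qed

lemma pos_or_neg: "\<beta> \<in> \<Delta> \<Longrightarrow> \<beta> \<in> \<Phi> \<or> - \<beta> \<in> \<Phi>"
  using simple_decomp[of \<beta>] root_uminus[of \<beta>] unfolding pos_roots_def by fastforce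

lemma not_pos_and_neg: "\<beta> \<in> \<Phi> \<Longrightarrow> - \<beta> \<notin> \<Phi>"
  using pos_root_ht[of \<beta>] pos_root_ht[of "- \<beta>"] by (auto simp: linear_neg[OF linear_ht])

lemma pos_iff_not_neg: "\<beta> \<in> \<Delta> \<Longrightarrow> - \<beta> \<in> \<Phi> \<longleftrightarrow> \<beta> \<notin> \<Phi>"
  using pos_or_neg not_pos_and_neg by blast

lemma simple_pos: "\<sigma> i \<in> \<Phi>"
proof -
  have "ht (- \<sigma> i) < 0" by (simp add: linear_neg[OF linear_ht] ht_simple)
  then show ?thesis using pos_or_neg[OF simple_root] pos_root_ht by fastforce
qed

lemma simple_nonzero [simp]: "\<sigma> i \<noteq> 0"
  using simple_root root_nonzero by blast

text \<open>In a reduced system the line through a simple root contains no roots besides that root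
  and its negative.\<close>

lemma root_other_coord:
  assumes "\<beta> \<in> \<Delta>" "\<beta> \<noteq> \<sigma> i" "\<beta> \<noteq> - \<sigma> i"
  shows "\<exists>j. j \<noteq> i \<and> coord j \<beta> \<noteq> 0"
proof (rule ccontr)
  assume "\<not> ?thesis"
  then have "(\<Sum>j\<in>UNIV. coord j \<beta> *\<^sub>R \<sigma> j) = (\<Sum>j\<in>UNIV. if j = i then coord i \<beta> *\<^sub>R \<sigma> i else 0)"
    by (intro sum.cong) auto
  then have *: "\<beta> = coord i \<beta> *\<^sub>R \<sigma> i" using coord_root_expand[OF assms(1)] by simp
  with assms(1) have "coord i \<beta> *\<^sub>R \<sigma> i \<in> \<Delta>" by simp
  from root_reduced[OF simple_root this] * assms(2,3) show False by auto
qed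

text \<open>The reflection changes only the coordinate at \<open>i\<close>. A positive root other
  than \<open>\<sigma> i\<close> has a positive coordinate elsewhere, and a root with one positive
  coordinate is positive because signs of coordinates never mix.\<close>

lemma simple_refl_pos:
  assumes "\<beta> \<in> \<Phi>" "\<beta> \<noteq> \<sigma> i"
  shows "root_refl (\<sigma> i) \<beta> \<in> \<Phi>"
proof -
  have \<beta>: "\<beta> \<in> \<Delta>" using assms pos_root_root by blast
  have "\<beta> \<noteq> - \<sigma> i" using not_pos_and_neg[OF simple_pos] assms(1) by blast
  then obtain j where j: "j \<noteq> i" "coord j \<beta> \<noteq> 0"
    using root_other_coord[OF \<beta> assms(2)] by blast
  then have "coord j (root_refl (\<sigma> i) \<beta>) > 0"
    using pos_root_coord_nonneg[OF assms(1), of j]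
    by (simp add: root_refl_def linear_diff[OF linear_coord] linear_cmul[OF linear_coord] coord_simple)
  then have "- root_refl (\<sigma> i) \<beta> \<notin> \<Phi>"
    using pos_root_coord_nonneg[of "- root_refl (\<sigma> i) \<beta>" j] by (auto simp: linear_neg[OF linear_coord])
  then show ?thesis using pos_or_neg root_refl_root[OF \<beta> simple_root] by blast
qed

text \<open>Descent on height. As \<beta> has positive inner product with itself, it has positive
  inner product with some simple root occurring in it. Reflecting there lowers the height by a
  positive integer and, unless \<beta> is simple, stays among the positive roots.\<close>

lemma pos_root_word:
  assumes "\<beta> \<in> \<Phi>"
  shows "\<exists>is i. \<beta> = word \<sigma> is (\<sigma> i)"
proof -
  \<comment> \<open>\<open>ht\<close> is real valued; its floor is the measure, and a drop of the
    height by at least 1 lowers the floor too.\<close>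
  have "\<exists>is i. \<beta> = word \<sigma> is (\<sigma> i)" if "\<beta> \<in> \<Phi>" "nat \<lfloor>ht \<beta>\<rfloor> = n" for n \<beta>
    using that
  proof (induction n arbitrary: \<beta> rule: less_induct)
    case (less n)
    have \<beta>: "\<beta> \<in> \<Delta>" using less.prems pos_root_root by blast
    show ?case
    proof (cases "\<beta> \<in> range \<sigma>")
      case True
      then show ?thesis using word_Nil by (metis id_apply imageE)
    next
      case False
      have "\<beta> \<bullet> \<beta> = (\<Sum>i\<in>UNIV. coord i \<beta> * (\<sigma> i \<bullet> \<beta>))"
        by (subst (1) coord_root_expand[OF \<beta>]) (simp add: inner_sum_left)
      moreover have "\<beta> \<bullet> \<beta> > 0" using root_nonzero[OF \<beta>] by simp
      ultimately obtain i where i: "coord i \<beta> * (\<sigma> i \<bullet> \<beta>) > 0"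
        by (metis (no_types, lifting) linorder_not_le sum_nonpos)
      then have ip: "\<beta> \<bullet> \<sigma> i > 0"
        using pos_root_coord_nonneg[OF less.prems(1), of i] by (simp add: zero_less_mult_iff inner_commute)
      define k where "k = 2 * (\<beta> \<bullet> \<sigma> i) / (\<sigma> i \<bullet> \<sigma> i)"
      have "k > 0" unfolding k_def using ip by simp
      moreover have "k \<in> \<int>" unfolding k_def by (rule root_integral[OF \<beta> simple_root])
      ultimately have k: "k \<ge> 1" by (auto elim!: Ints_cases)
      define \<gamma> where "\<gamma> = root_refl (\<sigma> i) \<beta>"
      have \<gamma>: "\<gamma> \<in> \<Phi>" unfolding \<gamma>_def using simple_refl_pos less.prems(1) False by blast
      have "ht \<gamma> = ht \<beta> - k"
        by (simp add: \<gamma>_def root_refl_def linear_diff[OF linear_ht] linear_cmul[OF linear_ht] ht_simple k_def)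
      then have "ht \<gamma> \<le> ht \<beta> - 1" using k by simp
      then have "\<lfloor>ht \<gamma>\<rfloor> \<le> \<lfloor>ht \<beta>\<rfloor> - 1" by linarith
      moreover have "0 \<le> \<lfloor>ht \<gamma>\<rfloor>" using pos_root_ht[OF \<gamma>] by simp
      ultimately have "nat \<lfloor>ht \<gamma>\<rfloor> < n" using less.prems(2) by linarith
      then obtain "is" j where "\<gamma> = word \<sigma> is (\<sigma> j)" using less.IH \<gamma> by blast
      then have "\<beta> = word \<sigma> (i # is) (\<sigma> j)"
        using root_refl_involutive[of "\<sigma> i" \<beta>] by (simp add: \<gamma>_def)
      then show ?thesis by blast
    qed
  qed
  then show ?thesis using assms by blast
qed

lemma root_word: "\<beta> \<in> \<Delta> \<Longrightarrow> \<exists>is i. \<beta> = word \<sigma> is (\<sigma> i)"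
proof -
  assume "\<beta> \<in> \<Delta>"
  then consider "\<beta> \<in> \<Phi>" | "- \<beta> \<in> \<Phi>" using pos_or_neg by blast
  then show ?thesis
  proof cases
    case 2
    then obtain "is" i where "- \<beta> = word \<sigma> is (\<sigma> i)" using pos_root_word by blast
    \<comment> \<open>The extra letter \<open>i\<close> flips the sign of
      \<open>\<sigma> i\<close>.\<close>
    then have "\<beta> = word \<sigma> (is @ [i]) (\<sigma> i)"
      using linear_neg[of "word \<sigma> is"] orthogonal_word[of \<sigma> "is"]
      by (simp add: word_append root_refl_self orthogonal_transformation_linear) (metis minus_minus)
    then show ?thesis by blast
  qed (rule pos_root_word)
qed

section \<open>The Weyl group as the group of words\<close>

lemma word_weyl: "word \<sigma> is \<in> W"
proof (induction "is")
  case Nil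
  show ?case unfolding word_Nil by (rule weyl_id)
next
  case (Cons i "is")
  then show ?case unfolding word_Cons by (rule weyl_refl[OF _ simple_root])
qed

lemma weyl_eq_words: "W = range (word \<sigma>)"
proof
  show "W \<subseteq> range (word \<sigma>)"
  proof
    fix w assume "w \<in> W"
    then show "w \<in> range (word \<sigma>)"
    proof induction
      case weyl_id
      then show ?case by (metis rangeI word_Nil)
    next
      case (weyl_refl w \<beta>)
      then obtain js "is" i where "w = word \<sigma> js" "\<beta> = word \<sigma> is (\<sigma> i)" using root_word by blast
      then have "root_refl \<beta> \<circ> w = word \<sigma> ((is @ i # rev is) @ js)"
        unfolding word_append[of _ "is @ i # rev is"] by (simp only: root_refl_word)
      then show ?case by blast
    qed
  qed
qed (use word_weyl in blast)

lemma weyl_comp: "u \<in> W \<Longrightarrow> v \<in> W \<Longrightarrow> u \<circ> v \<in> W"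
  unfolding weyl_eq_words by (auto simp flip: word_append)

lemma refl_weyl: "\<beta> \<in> \<Delta> \<Longrightarrow> root_refl \<beta> \<in> W"
  using weyl_refl[OF weyl_id] by simp

lemma weyl_comp_refl_iff: "\<beta> \<in> \<Delta> \<Longrightarrow> w \<circ> root_refl \<beta> \<in> W \<longleftrightarrow> w \<in> W"
  using weyl_comp[OF _ refl_weyl, of "w \<circ> root_refl \<beta>" \<beta>] weyl_comp[OF _ refl_weyl, of w \<beta>]
  by (auto simp: comp_assoc)

lemma weyl_inv:
  assumes "w \<in> W"
  shows "inv w \<in> W" "w (inv w x) = x" "inv w (w x) = x"
proof -
  obtain "is" where w: "w = word \<sigma> is" using assms weyl_eq_words by blast
  have 1: "w \<circ> word \<sigma> (rev is) = id" unfolding w by (rule word_rev)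
  have 2: "word \<sigma> (rev is) \<circ> w = id" unfolding w using word_rev[of \<sigma> "rev is"] by simp
  have "inv w = word \<sigma> (rev is)" using inv_unique_comp[OF 1 2] .
  then show "inv w \<in> W" "w (inv w x) = x" "inv w (w x) = x"
    using fun_cong[OF 1, of x] fun_cong[OF 2, of x] word_weyl by simp_all
qed

lemma weyl_orthogonal: "w \<in> W \<Longrightarrow> orthogonal_transformation w"
  using weyl_eq_words orthogonal_word by auto

lemma weyl_linear: "w \<in> W \<Longrightarrow> linear w"
  using weyl_orthogonal orthogonal_transformation_linear by blast

lemma weyl_uminus: "w \<in> W \<Longrightarrow> w (- x) = - w x"
  using weyl_linear linear_neg by blast

lemma weyl_root: "w \<in> W \<Longrightarrow> \<beta> \<in> \<Delta> \<Longrightarrow> w \<beta> \<in> \<Delta>"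
  by (induction arbitrary: rule: weyl.induct) (auto simp: root_refl_root)

lemma weyl_comp_root_refl: "w \<in> W \<Longrightarrow> w \<circ> root_refl \<beta> = root_refl (w \<beta>) \<circ> w"
  by (rule orthogonal_comp_root_refl[OF weyl_orthogonal])

lemma weyl_cancel_right:
  assumes "w \<in> W" "f \<circ> w = g \<circ> w"
  shows "f = g"
proof
  fix x
  show "f x = g x" using fun_cong[OF assms(2), of "inv w x"] by (simp add: weyl_inv[OF assms(1)])
qed

text \<open>The common reflection sends \<beta> to -\<beta>, which makes \<beta> a multiple of
  \<gamma>; reducedness and positivity leave only the factor 1.\<close>

lemma root_refl_eq_iff:
  assumes "\<beta> \<in> \<Phi>" "\<gamma> \<in> \<Phi>" "root_refl \<beta> = root_refl \<gamma>"
  shows "\<beta> = \<gamma>"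
proof -
  have roots: "\<beta> \<in> \<Delta>" "\<gamma> \<in> \<Delta>" using assms pos_root_root by auto
  have "- \<beta> = root_refl \<gamma> \<beta>"
    using root_refl_self[OF root_nonzero[OF roots(1)]] assms(3) by metis
  then have "2 *\<^sub>R \<beta> = (2 * (\<beta> \<bullet> \<gamma>) / (\<gamma> \<bullet> \<gamma>)) *\<^sub>R \<gamma>"
    by (simp add: root_refl_def scaleR_2 algebra_simps)
  then have "(1/2) *\<^sub>R 2 *\<^sub>R \<beta> = (1/2) *\<^sub>R (2 * (\<beta> \<bullet> \<gamma>) / (\<gamma> \<bullet> \<gamma>)) *\<^sub>R \<gamma>" by (rule arg_cong)
  then obtain c where c: "\<beta> = c *\<^sub>R \<gamma>" by auto
  then have "c = 1 \<or> c = -1" using root_reduced roots by metis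
  then show ?thesis using c assms not_pos_and_neg by auto
qed

section \<open>Inversions, exchange and length\<close>

definition inversions :: "('v \<Rightarrow> 'v) \<Rightarrow> 'v set" where
  "inversions w = {\<beta> \<in> \<Phi>. - inv w \<beta> \<in> \<Phi>}"

lemma inversions_subset: "inversions w \<subseteq> \<Phi>"
  by (auto simp: inversions_def)

lemma finite_inversions: "finite (inversions w)"
  using finite_subset[OF inversions_subset finite_pos_roots] .

lemma inv_refl_comp: "w \<in> W \<Longrightarrow> inv (root_refl \<beta> \<circ> w) = inv w \<circ> root_refl \<beta>"
  by (rule inv_unique_comp) (auto simp: fun_eq_iff weyl_inv)

text \<open>Inversions are defined for left multiplication, since the GKM condition compares w with
  r_\<beta> w. Passing between these two elements changes the sign of w^-1 \<beta>, so exactly one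
  of them has \<beta> as an inversion.\<close>

lemma inversion_refl_comp_iff:
  assumes "w \<in> W" "\<beta> \<in> \<Phi>"
  shows "\<beta> \<in> inversions (root_refl \<beta> \<circ> w) \<longleftrightarrow> \<beta> \<notin> inversions w"
  using assms pos_iff_not_neg[OF weyl_root[OF weyl_inv(1)[OF assms(1)] pos_root_root[OF assms(2)]]]
  by (auto simp: inversions_def inv_refl_comp root_refl_self root_nonzero pos_root_root
      weyl_uminus weyl_inv(1))

text \<open>Strong exchange, for words that may fail to be reduced. When the first letter is peeled
  off, \<beta> is either its simple root or is carried by its reflection to an inversion of the
  rest.\<close>

lemma exchange:
  assumes "\<beta> \<in> inversions (word \<sigma> is)"
  shows "\<exists>xs i ys. is = xs @ i # ys \<and> \<beta> = word \<sigma> xs (\<sigma> i)"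
  using assms
proof (induction "is" arbitrary: \<beta>)
  case Nil
  then show ?case using not_pos_and_neg by (auto simp: inversions_def)
next
  case (Cons i "is")
  show ?case
  proof (cases "\<beta> = \<sigma> i")
    case True
    then show ?thesis by (intro exI[of _ "[]"]) auto
  next
    case False
    have "\<beta> \<in> \<Phi>" "- inv (word \<sigma> is) (root_refl (\<sigma> i) \<beta>) \<in> \<Phi>"
      using Cons.prems unfolding inversions_def word_Cons inv_refl_comp[OF word_weyl] by auto
    then have "root_refl (\<sigma> i) \<beta> \<in> inversions (word \<sigma> is)"
      using simple_refl_pos False by (simp add: inversions_def)
    then obtain xs j ys where "is = xs @ j # ys" "root_refl (\<sigma> i) \<beta> = word \<sigma> xs (\<sigma> j)"
      using Cons.IH by blast
    then have "i # is = (i # xs) @ j # ys \<and> \<beta> = word \<sigma> (i # xs) (\<sigma> j)"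
      by simp (metis root_refl_involutive)
    then show ?thesis by blast
  qed
qed

text \<open>By conjugation the reflection passes through the prefix, becomes the simple reflection
  of the letter \<open>i\<close>, and cancels it.\<close>

lemma refl_word_deletion:
  "root_refl (word \<sigma> xs (\<sigma> i)) \<circ> word \<sigma> (xs @ i # ys) = word \<sigma> (xs @ ys)"
proof
  fix x
  have "root_refl (word \<sigma> xs (\<sigma> i)) (word \<sigma> xs y) = word \<sigma> xs (root_refl (\<sigma> i) y)" for y
    using fun_cong[OF orthogonal_comp_root_refl[OF orthogonal_word[of \<sigma> xs], of "\<sigma> i"], of y]
    by simp
  then show "(root_refl (word \<sigma> xs (\<sigma> i)) \<circ> word \<sigma> (xs @ i # ys)) x = word \<sigma> (xs @ ys) x"
    by (simp add: word_append)
qed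

lemma reduced_word:
  assumes "w \<in> W" obtains "is" where "w = word \<sigma> is" "length is = \<l> w"
  using assms reduced_word_exists weyl_eq_words by (metis imageE)

lemma inversion_len_less:
  assumes "w \<in> W" "\<beta> \<in> inversions w"
  shows "\<l> (root_refl \<beta> \<circ> w) < \<l> w"
proof -
  obtain "is" where w: "w = word \<sigma> is" "length is = \<l> w" using reduced_word assms(1) by blast
  then obtain xs i ys where x: "is = xs @ i # ys" "\<beta> = word \<sigma> xs (\<sigma> i)" using exchange assms(2) by blast
  then have "root_refl \<beta> \<circ> w = word \<sigma> (xs @ ys)" using w refl_word_deletion by simp
  then have "\<l> (root_refl \<beta> \<circ> w) \<le> length (xs @ ys)" using len_word_le by metis
  then show ?thesis using w(2) x(1) by simp
qed

text \<open>If \<beta> is not an inversion of w, then it is one of r_\<beta> w, and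
  \<open>inversion_len_less\<close> applied there gives the opposite strict inequality.\<close>

lemma inversion_iff_len:
  assumes "w \<in> W" "\<beta> \<in> \<Phi>"
  shows "\<beta> \<in> inversions w \<longleftrightarrow> \<l> (root_refl \<beta> \<circ> w) < \<l> w"
proof (cases "\<beta> \<in> inversions w")
  case False
  then have "\<l> w < \<l> (root_refl \<beta> \<circ> w)"
    using inversion_len_less[of "root_refl \<beta> \<circ> w" \<beta>] inversion_refl_comp_iff[OF assms]
      assms weyl_refl[OF assms(1) pos_root_root[OF assms(2)]]
    by (simp add: comp_assoc[symmetric])
  then show ?thesis using False by simp
qed (simp add: inversion_len_less assms)

lemma bruhat_less_iff_inversion:
  assumes "w \<in> W" "\<beta> \<in> \<Phi>"
  shows "bruhat_less \<Delta> \<sigma> (root_refl \<beta> \<circ> w) w \<longleftrightarrow> \<beta> \<in> inversions w"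
  using bruhat_less_root_refl_iff[of "root_refl \<beta> \<circ> w" \<Delta> \<beta> \<sigma>] assms weyl_refl[OF assms(1)] pos_root_root[OF assms(2)]
  by (simp add: inversion_iff_len[OF assms] comp_assoc[symmetric])

text \<open>The simple reflection permutes the positive roots other than \<open>\<sigma> i\<close>,
  so it carries the old inversions to new ones, and \<open>\<sigma> i\<close> is the only one
  gained.\<close>

lemma inversions_simple_comp:
  assumes "w \<in> W" "\<sigma> i \<in> inversions (root_refl (\<sigma> i) \<circ> w)"
  shows "inversions (root_refl (\<sigma> i) \<circ> w) = insert (\<sigma> i) (root_refl (\<sigma> i) ` inversions w)"
    "\<sigma> i \<notin> root_refl (\<sigma> i) ` inversions w"
proof -
  have notin: "\<sigma> i \<notin> inversions w" using inversion_refl_comp_iff[OF assms(1) simple_pos] assms(2) by blast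
  show "\<sigma> i \<notin> root_refl (\<sigma> i) ` inversions w"
  proof
    assume "\<sigma> i \<in> root_refl (\<sigma> i) ` inversions w"
    then have "root_refl (\<sigma> i) (\<sigma> i) \<in> inversions w" by (metis imageE root_refl_involutive)
    then have "- \<sigma> i \<in> \<Phi>" using inversions_subset by (auto simp: root_refl_self)
    then show False using not_pos_and_neg simple_pos by blast
  qed
  have iff: "\<beta> \<in> inversions (root_refl (\<sigma> i) \<circ> w) \<longleftrightarrow> root_refl (\<sigma> i) \<beta> \<in> inversions w" if "\<beta> \<noteq> \<sigma> i" for \<beta>
  proof -
    have "\<beta> \<in> \<Phi>" if "root_refl (\<sigma> i) \<beta> \<in> inversions w"
    proof -
      have "root_refl (\<sigma> i) \<beta> \<noteq> \<sigma> i" using that notin by metis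
      then show ?thesis
        using that inversions_subset simple_refl_pos[of "root_refl (\<sigma> i) \<beta>" i] by auto
    qed
    then show ?thesis using simple_refl_pos[of \<beta> i] \<open>\<beta> \<noteq> \<sigma> i\<close>
      unfolding inversions_def inv_refl_comp[OF assms(1)] o_apply mem_Collect_eq by blast
  qed
  show "inversions (root_refl (\<sigma> i) \<circ> w) = insert (\<sigma> i) (root_refl (\<sigma> i) ` inversions w)" (is "?A = ?B")
  proof (intro set_eqI)
    fix \<beta>
    have image: "\<beta> \<in> root_refl (\<sigma> i) ` inversions w \<longleftrightarrow> root_refl (\<sigma> i) \<beta> \<in> inversions w"
      by (metis image_iff root_refl_involutive)
    show "\<beta> \<in> ?A \<longleftrightarrow> \<beta> \<in> ?B"
    proof (cases "\<beta> = \<sigma> i")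
      case False
      show ?thesis unfolding iff[OF False] insert_iff image using False by blast
    next
      case True
      show ?thesis unfolding True using assms(2) by blast
    qed
  qed
qed

text \<open>Each letter put in front of a reduced word, if the result is still reduced, reflects the
  earlier inversions and adds its own simple root. Length thereby becomes the number of inversions,
  the count behind every degree argument.\<close>

lemma reduced_inversions:
  assumes "\<l> (word \<sigma> is) = length is"
  shows "inversions (word \<sigma> is) = set (invlist \<sigma> is) \<and> distinct (invlist \<sigma> is)"
  using assms
proof (induction "is")
  case Nil
  then show ?case using not_pos_and_neg by (auto simp: inversions_def)
next
  case (Cons i "is")
  let ?w = "word \<sigma> is"
  obtain js where js: "length js = \<l> ?w" "word \<sigma> js = ?w" using reduced_word_exists by blast
  \<comment> \<open>The tail of a reduced word is reduced: a shorter word for the tail would shorten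
    the whole.\<close>
  have "\<l> (word \<sigma> (i # js)) \<le> Suc (\<l> ?w)" using len_word_le[of \<sigma> "i # js"] js by simp
  then have red: "\<l> ?w = length is"
    using Cons.prems len_word_le[of \<sigma> "is"] js unfolding word_Cons by simp
  have "\<sigma> i \<in> inversions (root_refl (\<sigma> i) \<circ> ?w)"
    using inversion_iff_len[of "root_refl (\<sigma> i) \<circ> ?w" "\<sigma> i"] simple_pos word_weyl[of "i # is"] Cons.prems red
    unfolding word_Cons by (simp add: comp_assoc[symmetric])
  note step = inversions_simple_comp[OF word_weyl this]
  have "inj_on (root_refl (\<sigma> i)) (set (invlist \<sigma> is))"
    by (rule inj_on_inverseI) (rule root_refl_involutive)
  then have "distinct (invlist \<sigma> (i # is))"
    using step(2) Cons.IH[OF red] by (simp add: distinct_map)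
  moreover have "inversions (word \<sigma> (i # is)) = set (invlist \<sigma> (i # is))"
    unfolding word_Cons step(1) using Cons.IH[OF red] by simp
  ultimately show ?case by blast
qed

lemma len_eq_card_inversions:
  assumes "w \<in> W"
  shows "\<l> w = card (inversions w)"
proof -
  obtain "is" where w: "w = word \<sigma> is" "length is = \<l> w" using reduced_word assms(1) by blast
  then show ?thesis using reduced_inversions[of "is"] distinct_card[of "invlist \<sigma> is"] by simp
qed

text \<open>Right multiplication by r_\<beta> is left multiplication by the reflection in w \<beta>,
  so the sign of w \<beta> decides which of the two elements has w \<beta> or its negative as an
  inversion.\<close>

lemma right_mult_len:
  assumes "w \<in> W" "\<beta> \<in> \<Phi>"
  shows "w \<beta> \<in> \<Phi> \<Longrightarrow> \<l> w < \<l> (w \<circ> root_refl \<beta>)"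
    and "w \<beta> \<notin> \<Phi> \<Longrightarrow> \<l> (w \<circ> root_refl \<beta>) < \<l> w"
proof -
  have root: "w \<beta> \<in> \<Delta>" using assms weyl_root pos_root_root by blast
  show "\<l> w < \<l> (w \<circ> root_refl \<beta>)" if "w \<beta> \<in> \<Phi>"
  proof -
    have "w \<beta> \<notin> inversions w" using assms not_pos_and_neg by (simp add: inversions_def weyl_inv)
    then have "w \<beta> \<in> inversions (root_refl (w \<beta>) \<circ> w)" using inversion_refl_comp_iff assms that by blast
    from inversion_len_less[OF weyl_refl[OF assms(1) root] this]
    show ?thesis by (simp add: weyl_comp_root_refl[OF assms(1)] comp_assoc[symmetric])
  qed
  show "\<l> (w \<circ> root_refl \<beta>) < \<l> w" if "w \<beta> \<notin> \<Phi>"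
  proof -
    have "- w \<beta> \<in> inversions w"
      using that pos_iff_not_neg[OF root] assms by (simp add: inversions_def weyl_inv weyl_uminus)
    from inversion_len_less[OF assms(1) this]
    show ?thesis by (simp add: weyl_comp_root_refl[OF assms(1)] root_refl_uminus)
  qed
qed

lemma len_comp_simple_le:
  assumes "w \<in> W"
  shows "\<l> (w \<circ> root_refl (\<sigma> i)) \<le> Suc (\<l> w)"
proof -
  obtain "is" where w: "w = word \<sigma> is" "length is = \<l> w" using reduced_word assms(1) by blast
  then show ?thesis using len_word_le[of \<sigma> "is @ [i]"] by (simp add: word_append)
qed

lemma len_comp_simple:
  assumes "w \<in> W" "w (\<sigma> i) \<in> \<Phi>"
  shows "\<l> (w \<circ> root_refl (\<sigma> i)) = Suc (\<l> w)"
  using right_mult_len(1)[OF assms(1) simple_pos assms(2)] len_comp_simple_le[OF assms(1), of i] by simp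

text \<open>A positive root is a nonnegative combination of simple roots, so w sends it to height at
  most 0 and its image cannot be positive. Such a w is the longest element, the starting point for
  constructing Schubert classes.\<close>

lemma inversions_top:
  assumes "w \<in> W" "\<And>i. w (\<sigma> i) \<notin> \<Phi>"
  shows "inversions w = \<Phi>"
proof -
  have "- inv w \<beta> \<in> \<Phi>" if \<beta>: "\<beta> \<in> \<Phi>" for \<beta>
  proof (rule ccontr)
    assume "- inv w \<beta> \<notin> \<Phi>"
    define \<gamma> where "\<gamma> = inv w \<beta>"
    have \<gamma>: "\<gamma> \<in> \<Phi>" using \<open>- inv w \<beta> \<notin> \<Phi>\<close> pos_or_neg weyl_root[OF weyl_inv(1)[OF assms(1)] pos_root_root[OF \<beta>]]
      unfolding \<gamma>_def by blast
    have "ht (w (\<sigma> i)) \<le> 0" for i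
      using pos_root_ht[of "- w (\<sigma> i)"] assms(2)[of i] pos_or_neg[OF weyl_root[OF assms(1) simple_root[of i]]]
      by (simp add: linear_neg[OF linear_ht])
    moreover have "ht (w \<gamma>) = (\<Sum>i\<in>UNIV. coord i \<gamma> * ht (w (\<sigma> i)))"
    proof -
      have "w \<gamma> = w (\<Sum>i\<in>UNIV. coord i \<gamma> *\<^sub>R \<sigma> i)"
        using coord_root_expand[OF pos_root_root[OF \<gamma>]] by (rule arg_cong)
      also have "\<dots> = (\<Sum>i\<in>UNIV. coord i \<gamma> *\<^sub>R w (\<sigma> i))"
        by (simp only: linear_sum[OF weyl_linear[OF assms(1)]] linear_cmul[OF weyl_linear[OF assms(1)]])
      finally show ?thesis
        by (simp only: linear_sum[OF linear_ht] linear_cmul[OF linear_ht] real_scaleR_def)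
    qed
    ultimately have "ht (w \<gamma>) \<le> 0"
      using pos_root_coord_nonneg[OF \<gamma>] by (simp add: sum_nonpos mult_nonneg_nonpos)
    moreover have "w \<gamma> = \<beta>" by (simp add: \<gamma>_def weyl_inv assms(1))
    ultimately show False using pos_root_ht[OF \<beta>] by simp
  qed
  then show ?thesis by (auto simp: inversions_def)
qed

subsection \<open>Roots as linear forms\<close>

abbreviation \<h> :: "'v \<Rightarrow> 'i H" where "\<h> \<equiv> root_H \<sigma>"

text \<open>The root lattice, the domain on which \<open>root_H\<close> is meaningful:
  \<open>root_coeff\<close> is a definite description, unspecified for vectors without integer
  coordinates.\<close>

definition lattice :: "'v set" where
  "lattice = {x. \<exists>c :: 'i \<Rightarrow> int. x = (\<Sum>i\<in>UNIV. real_of_int (c i) *\<^sub>R \<sigma> i)}"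

lemma root_H_lincomb:
  "\<h> (\<Sum>i\<in>UNIV. real_of_int (c i) *\<^sub>R \<sigma> i) = (\<Sum>i\<in>UNIV. frag_cmul (c i) (var i))"
proof -
  have "c' = c" if "(\<Sum>i\<in>UNIV. real_of_int (c i) *\<^sub>R \<sigma> i) = (\<Sum>i\<in>UNIV. real_of_int (c' i) *\<^sub>R \<sigma> i)" for c'
  proof
    fix j show "c' j = c j"
      using arg_cong[OF that, of "coord j"] by (simp add: coord_lincomb)
  qed
  then have "root_coeff \<sigma> (\<Sum>i\<in>UNIV. real_of_int (c i) *\<^sub>R \<sigma> i) = c"
    unfolding root_coeff_def by (intro the_equality) auto
  moreover have "Poly_Mapping.single (Poly_Mapping.single i 1) k = frag_cmul k (var i)" for i :: 'i and k
    by (rule poly_mapping_eqI) (simp add: var_def lookup_single when_def)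
  ultimately show ?thesis by (simp add: root_H_def)
qed

text \<open>Negatives, integer combinations and reflections are all built from x - n y, so this one
  identity carries the additivity of \<open>root_H\<close>.\<close>

lemma lattice_diff_scale:
  assumes "x \<in> lattice" "y \<in> lattice"
  shows "x - real_of_int n *\<^sub>R y \<in> lattice"
    and "\<h> (x - real_of_int n *\<^sub>R y) = \<h> x - of_int n * \<h> y"
proof -
  obtain c d where x: "x = (\<Sum>i\<in>UNIV. real_of_int (c i) *\<^sub>R \<sigma> i)"
    and y: "y = (\<Sum>i\<in>UNIV. real_of_int (d i) *\<^sub>R \<sigma> i)"
    using assms unfolding lattice_def by blast
  have eq: "x - real_of_int n *\<^sub>R y = (\<Sum>i\<in>UNIV. real_of_int (c i - n * d i) *\<^sub>R \<sigma> i)"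
    by (simp add: x y scaleR_sum_right sum_subtractf scaleR_left_diff_distrib)
  show "x - real_of_int n *\<^sub>R y \<in> lattice"
    unfolding lattice_def eq by (intro CollectI exI[of _ "\<lambda>i. c i - n * d i"]) (rule refl)
  have "frag_cmul (c i - n * d i) (var i) = frag_cmul (c i) (var i) - frag_cmul n (frag_cmul (d i) (var i))" for i
    using frag_cmul_distrib[of "c i - n * d i" "n * d i" "var i"] by (simp add: algebra_simps)
  then show "\<h> (x - real_of_int n *\<^sub>R y) = \<h> x - of_int n * \<h> y"
    unfolding eq unfolding x y root_H_lincomb of_int_mult_frag
    by (simp add: sum_subtractf frag_cmul_sum)
qed

lemma zero_lattice: "0 \<in> lattice" and root_H_0: "\<h> 0 = 0"
  using root_H_lincomb[of "\<lambda>_. 0"] by (auto simp: lattice_def intro!: exI[of _ "\<lambda>_. 0"])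

lemma lattice_uminus:
  assumes "x \<in> lattice" shows "- x \<in> lattice" "\<h> (- x) = - \<h> x"
  using lattice_diff_scale[OF zero_lattice assms, of 1] by (simp_all add: root_H_0)

lemma lattice_sum:
  assumes "finite A" "\<And>i. i \<in> A \<Longrightarrow> y i \<in> lattice"
  shows "(\<Sum>i\<in>A. real_of_int (c i) *\<^sub>R y i) \<in> lattice
    \<and> \<h> (\<Sum>i\<in>A. real_of_int (c i) *\<^sub>R y i) = (\<Sum>i\<in>A. frag_cmul (c i) (\<h> (y i)))"
  using assms
proof (induction A rule: finite_induct)
  case (insert j A)
  let ?x = "\<Sum>i\<in>A. real_of_int (c i) *\<^sub>R y i"
  have "?x \<in> lattice" "y j \<in> lattice" using insert by blast+
  from lattice_diff_scale[OF this, of "- c j"] insert show ?case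
    by (simp add: add.commute flip: of_int_mult_frag)
qed (simp add: zero_lattice root_H_0)

lemma root_lattice: "\<beta> \<in> \<Delta> \<Longrightarrow> \<beta> \<in> lattice"
proof -
  have nat: "(\<Sum>i\<in>UNIV. real (c i) *\<^sub>R \<sigma> i) \<in> lattice" for c :: "'i \<Rightarrow> nat"
    unfolding lattice_def by (intro CollectI exI[of _ "\<lambda>i. int (c i)"]) simp
  assume "\<beta> \<in> \<Delta>"
  then obtain c :: "'i \<Rightarrow> nat" where
    "\<beta> = (\<Sum>i\<in>UNIV. real (c i) *\<^sub>R \<sigma> i) \<or> \<beta> = - (\<Sum>i\<in>UNIV. real (c i) *\<^sub>R \<sigma> i)"
    using simple_decomp by blast
  then show ?thesis using nat lattice_uminus by metis
qed

lemma root_H_simple: "\<h> (\<sigma> i) = var i"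
proof -
  have "(\<Sum>j\<in>UNIV. real_of_int (if j = i then 1 else 0) *\<^sub>R \<sigma> j) = (\<Sum>j\<in>UNIV. if j = i then \<sigma> j else 0)"
    by (rule sum.cong) auto
  moreover have "(\<Sum>j\<in>UNIV. frag_cmul (if j = i then 1 else 0) (var j)) = (\<Sum>j\<in>UNIV. if j = i then var j else 0)"
    by (rule sum.cong) auto
  ultimately show ?thesis using root_H_lincomb[of "\<lambda>j. if j = i then 1 else 0"] by simp
qed

lemma root_H_uminus: "\<beta> \<in> \<Delta> \<Longrightarrow> \<h> (- \<beta>) = - \<h> \<beta>"
  using lattice_uminus(2)[OF root_lattice] .

lemma root_refl_pairing:
  assumes "\<alpha> \<in> \<Delta>" "\<beta> \<in> \<Delta>"
  shows "root_refl \<beta> \<alpha> = \<alpha> - real_of_int (pairing \<alpha> \<beta>) *\<^sub>R \<beta>"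
proof -
  obtain n where n: "2 * (\<alpha> \<bullet> \<beta>) / (\<beta> \<bullet> \<beta>) = real_of_int n"
    using root_integral[OF assms] Ints_cases by blast
  have eq: "root_refl \<beta> \<alpha> = \<alpha> - real_of_int n *\<^sub>R \<beta>" unfolding root_refl_def n ..
  have "pairing \<alpha> \<beta> = n"
    unfolding pairing_def eq using root_nonzero[OF assms(2)] by (intro the_equality) auto
  then show ?thesis using eq by simp
qed

lemma root_H_refl:
  assumes "\<alpha> \<in> \<Delta>" "\<beta> \<in> \<Delta>"
  shows "\<h> (root_refl \<beta> \<alpha>) = \<h> \<alpha> - of_int (pairing \<alpha> \<beta>) * \<h> \<beta>"
  unfolding root_refl_pairing[OF assms] by (rule lattice_diff_scale(2)[OF root_lattice root_lattice]) (fact assms)+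

lemma act_H_subst: "act_H \<sigma> w = subst (\<lambda>i. \<h> (w (\<sigma> i)))"
  by (simp add: fun_eq_iff act_H_def subst_def frag_extend_def of_int_mult_frag)

lemma act_H_root_H:
  assumes "w \<in> W" "x \<in> lattice"
  shows "act_H \<sigma> w (\<h> x) = \<h> (w x)"
proof -
  obtain c where x: "x = (\<Sum>i\<in>UNIV. real_of_int (c i) *\<^sub>R \<sigma> i)"
    using assms unfolding lattice_def by blast
  have "w x = (\<Sum>i\<in>UNIV. real_of_int (c i) *\<^sub>R w (\<sigma> i))"
    unfolding x by (simp only: linear_sum[OF weyl_linear[OF assms(1)]] linear_cmul[OF weyl_linear[OF assms(1)]])
  moreover have "\<h> (\<Sum>i\<in>UNIV. real_of_int (c i) *\<^sub>R w (\<sigma> i)) = (\<Sum>i\<in>UNIV. frag_cmul (c i) (\<h> (w (\<sigma> i))))"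
    using lattice_sum[OF finite, of UNIV "\<lambda>i. w (\<sigma> i)" c] root_lattice weyl_root[OF assms(1) simple_root] by blast
  moreover have "act_H \<sigma> w (\<h> x) = (\<Sum>i\<in>UNIV. frag_cmul (c i) (\<h> (w (\<sigma> i))))"
    unfolding x root_H_lincomb act_H_subst by (simp add: subst_sum subst_cmul)
  ultimately show ?thesis by simp
qed

lemma act_H_inv:
  assumes "w \<in> W"
  shows "act_H \<sigma> w (act_H \<sigma> (inv w) f) = f"
proof -
  have "act_H \<sigma> w (act_H \<sigma> (inv w) f) = subst (\<lambda>i. act_H \<sigma> w (\<h> (inv w (\<sigma> i)))) f"
    unfolding act_H_subst subst_subst ..
  moreover have "act_H \<sigma> w (\<h> (inv w (\<sigma> i))) = var i" for i
    using act_H_root_H[OF assms root_lattice[OF weyl_root[OF weyl_inv(1)[OF assms] simple_root]]]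
    by (simp add: weyl_inv[OF assms] root_H_simple)
  ultimately show ?thesis by simp
qed

lemma act_H_dvd: "f dvd g \<Longrightarrow> act_H \<sigma> w f dvd act_H \<sigma> w g"
  unfolding act_H_subst by (auto simp: subst_mult)

lemma root_H_expand:
  assumes "\<beta> \<in> \<Delta>"
  obtains c where "\<h> \<beta> = (\<Sum>i\<in>UNIV. frag_cmul (c i) (var i))" "\<And>i. coord i \<beta> = real_of_int (c i)"
proof -
  obtain c where c: "\<beta> = (\<Sum>i\<in>UNIV. real_of_int (c i) *\<^sub>R \<sigma> i)"
    using root_lattice[OF assms] unfolding lattice_def by blast
  show ?thesis by (rule that[of c]) (simp_all add: c root_H_lincomb coord_lincomb)
qed

lemma root_H_nonzero:
  assumes "\<beta> \<in> \<Delta>" shows "\<h> \<beta> \<noteq> 0"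
proof
  assume 0: "\<h> \<beta> = 0"
  obtain c where c: "\<h> \<beta> = (\<Sum>i\<in>UNIV. frag_cmul (c i) (var i))" "\<And>i. coord i \<beta> = real_of_int (c i)"
    using root_H_expand[OF assms] by blast
  have "c i = 0" for i using lookup_linear_form[of c i] c(1) 0 by simp
  then have "\<beta> = 0" using coord_root_expand[OF assms] c(2) by simp
  then show False using root_nonzero[OF assms] by blast
qed

lemma homogeneous_root_H: "\<beta> \<in> \<Delta> \<Longrightarrow> homogeneous 2 (\<h> \<beta>)"
proof -
  assume "\<beta> \<in> \<Delta>"
  then obtain c where c: "\<h> \<beta> = (\<Sum>i\<in>UNIV. frag_cmul (c i) (var i))" using root_H_expand by metis
  show ?thesis unfolding c of_int_mult_frag[symmetric]
    by (intro homogeneous_sum homogeneous_of_int_mult homogeneous_var)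
qed

text \<open>The Weyl group moves \<open>\<beta>\<close> to a simple root, whose linear form is a variable.\<close>

lemma roots_coprime:
  assumes "\<beta> \<in> \<Delta>" "\<gamma> \<in> \<Delta>" "\<gamma> \<noteq> \<beta>" "\<gamma> \<noteq> - \<beta>" "\<h> \<beta> dvd \<h> \<gamma> * f"
  shows "\<h> \<beta> dvd f"
proof -
  obtain "is" i where \<beta>: "\<beta> = word \<sigma> is (\<sigma> i)" using root_word[OF assms(1)] by blast
  define w where "w = word \<sigma> is"
  have w: "w \<in> W" unfolding w_def by (rule word_weyl)
  note iw = weyl_inv[OF w]
  have \<beta>': "\<beta> = w (\<sigma> i)" using \<beta> w_def by simp
  have \<gamma>': "inv w \<gamma> \<in> \<Delta>" by (rule weyl_root[OF iw(1) assms(2)])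
  have act: "act_H \<sigma> (inv w) (\<h> \<beta>) = var i" "act_H \<sigma> (inv w) (\<h> \<gamma>) = \<h> (inv w \<gamma>)"
    using act_H_root_H[OF iw(1) root_lattice[OF assms(1)]] act_H_root_H[OF iw(1) root_lattice[OF assms(2)]]
    by (simp_all add: \<beta>' iw root_H_simple)
  have "act_H \<sigma> (inv w) (\<h> \<beta>) dvd act_H \<sigma> (inv w) (\<h> \<gamma> * f)" by (rule act_H_dvd[OF assms(5)])
  then have dvd: "var i dvd \<h> (inv w \<gamma>) * act_H \<sigma> (inv w) f"
    unfolding act[symmetric] unfolding act_H_subst by (simp add: subst_mult)
  \<comment> \<open>Since \<gamma> is neither \<beta> nor its negative, the transported root has a
    nonzero coordinate away from \<open>i\<close>, as \<open>var_dvd_linear_form_mult\<close>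
    requires.\<close>
  have "inv w \<gamma> \<noteq> \<sigma> i" using assms(3) \<beta>' iw(2) by metis
  moreover have "inv w \<gamma> \<noteq> - \<sigma> i" using assms(4) \<beta>' iw(2) weyl_uminus[OF w] by metis
  ultimately obtain k where k: "k \<noteq> i" "coord k (inv w \<gamma>) \<noteq> 0" using root_other_coord[OF \<gamma>'] by blast
  obtain c where c: "\<h> (inv w \<gamma>) = (\<Sum>i\<in>UNIV. frag_cmul (c i) (var i))"
      "\<And>i. coord i (inv w \<gamma>) = real_of_int (c i)"
    using root_H_expand[OF \<gamma>'] by blast
  have "var i dvd act_H \<sigma> (inv w) f"
    by (rule var_dvd_linear_form_mult[OF dvd[unfolded c(1)] k(1)]) (use k(2) c(2) in simp)
  then have "act_H \<sigma> w (act_H \<sigma> (inv w) (\<h> \<beta>)) dvd act_H \<sigma> w (act_H \<sigma> (inv w) f)"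
    unfolding act(1) by (rule act_H_dvd)
  then show ?thesis unfolding act_H_inv[OF w] .
qed

lemma pos_roots_coprime:
  assumes "\<beta> \<in> \<Phi>" "\<gamma> \<in> \<Phi>" "\<beta> \<noteq> \<gamma>" "\<h> \<beta> dvd \<h> \<gamma> * f"
  shows "\<h> \<beta> dvd f"
proof (rule roots_coprime)
  show "\<gamma> \<noteq> - \<beta>" using not_pos_and_neg assms by blast
qed (use assms pos_root_root in auto)

lemma pos_roots_prod_dvd:
  assumes "A \<subseteq> \<Phi>" "\<And>\<delta>. \<delta> \<in> A \<Longrightarrow> \<h> \<delta> dvd f"
  shows "prod \<h> A dvd f"
proof (rule pairwise_coprime_prod_dvd)
  show "finite A" using assms(1) finite_pos_roots finite_subset by blast
  show "\<h> \<beta> dvd g" if "\<beta> \<in> A" "\<gamma> \<in> A" "\<beta> \<noteq> \<gamma>" "\<h> \<beta> dvd \<h> \<gamma> * g" for \<beta> \<gamma> g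
    using that assms(1) pos_roots_coprime by blast
qed (rule assms(2))

lemma homogeneous_pos_roots_prod: "A \<subseteq> \<Phi> \<Longrightarrow> homogeneous (2 * card A) (prod \<h> A)"
  using finite_pos_roots finite_subset homogeneous_root_H pos_root_root
  by (intro homogeneous_prod) blast+

lemma pos_roots_prod_nonzero: "A \<subseteq> \<Phi> \<Longrightarrow> prod \<h> A \<noteq> 0"
  using root_H_nonzero pos_root_root by (intro H_prod_nonzero) blast

text \<open>Distinct positive roots are coprime, so their product, of degree 2 * card A, divides f;
  a nonzero multiple cannot have smaller degree.\<close>

lemma pos_roots_dvd_eq_0:
  assumes "A \<subseteq> \<Phi>" "\<And>\<delta>. \<delta> \<in> A \<Longrightarrow> \<h> \<delta> dvd f" "homogeneous (2 * d) f" "d < card A"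
  shows "f = 0"
  using homogeneous_dvd_eq_0[OF homogeneous_pos_roots_prod[OF assms(1)]
      pos_roots_prod_nonzero[OF assms(1)] assms(3)] pos_roots_prod_dvd[OF assms(1,2)] assms(4)
  by auto

section \<open>Uniqueness and existence of Schubert classes\<close>

lemma gkm_dvd: "gkm_class \<Delta> \<sigma> p \<Longrightarrow> v \<in> W \<Longrightarrow> \<beta> \<in> \<Delta> \<Longrightarrow> \<h> \<beta> dvd p v - p (root_refl \<beta> \<circ> v)"
  and gkm_outside: "gkm_class \<Delta> \<sigma> p \<Longrightarrow> v \<notin> W \<Longrightarrow> p v = 0"
  by (auto simp: gkm_class_def)

lemma gkm_vanish:
  assumes "gkm_class \<Delta> \<sigma> p" "\<And>v. v \<in> W \<Longrightarrow> homogeneous (2 * d) (p v)"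
    and "\<And>v. v \<in> W \<Longrightarrow> \<l> v \<le> d \<Longrightarrow> p v = 0"
  shows "p v = 0"
proof (cases "v \<in> W")
  case True
  then show ?thesis
  proof (induction "\<l> v" arbitrary: v rule: less_induct)
    case less
    show ?case
    proof (cases "\<l> v \<le> d")
      case False
      have "\<h> \<delta> dvd p v" if \<delta>: "\<delta> \<in> inversions v" for \<delta>
      proof -
        have root: "\<delta> \<in> \<Delta>" using \<delta> inversions_subset pos_root_root by blast
        have "p (root_refl \<delta> \<circ> v) = 0"
          by (rule less.hyps[OF inversion_len_less[OF less.prems \<delta>] weyl_refl[OF less.prems root]])
        then show ?thesis using gkm_dvd[OF assms(1) less.prems root] by simp
      qed
      moreover have "d < card (inversions v)"
        using False unfolding len_eq_card_inversions[OF less.prems] by simp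
      ultimately show ?thesis
        by (rule pos_roots_dvd_eq_0[OF inversions_subset _ assms(2)[OF less.prems]])
    qed (simp add: assms(3) less.prems)
  qed
qed (rule gkm_outside[OF assms(1)])

lemma is_schubert_iff:
  assumes "w \<in> W"
  shows "is_schubert \<Delta> \<sigma> w p \<longleftrightarrow>
     gkm_class \<Delta> \<sigma> p \<and> (\<forall>v\<in>W. homogeneous (2 * \<l> w) (p v)) \<and>
     (\<forall>v\<in>W. \<l> v \<le> \<l> w \<and> v \<noteq> w \<longrightarrow> p v = 0) \<and> p w = prod \<h> (inversions w)"
proof -
  have "{\<beta> \<in> \<Phi>. bruhat_less \<Delta> \<sigma> (root_refl \<beta> \<circ> w) w} = inversions w"
    using bruhat_less_iff_inversion[OF assms] inversions_subset by blast
  then show ?thesis unfolding is_schubert_def by simp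
qed

lemma gkm_diff:
  assumes "gkm_class \<Delta> \<sigma> p" "gkm_class \<Delta> \<sigma> q"
  shows "gkm_class \<Delta> \<sigma> (\<lambda>v. p v - q v)"
  unfolding gkm_class_def
proof (intro conjI allI ballI impI)
  fix v \<beta> assume "v \<in> W" "\<beta> \<in> \<Delta>"
  then have "\<h> \<beta> dvd (p v - p (root_refl \<beta> \<circ> v)) - (q v - q (root_refl \<beta> \<circ> v))"
    by (intro dvd_diff gkm_dvd assms)
  then show "\<h> \<beta> dvd (p v - q v) - (p (root_refl \<beta> \<circ> v) - q (root_refl \<beta> \<circ> v))"
    by (simp add: algebra_simps)
qed (simp add: gkm_outside[OF assms(1)] gkm_outside[OF assms(2)])

lemma schubert_unique:
  assumes "w \<in> W" "is_schubert \<Delta> \<sigma> w p" "is_schubert \<Delta> \<sigma> w q"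
  shows "p = q"
proof
  fix v
  note p = assms(2)[unfolded is_schubert_iff[OF assms(1)]] and q = assms(3)[unfolded is_schubert_iff[OF assms(1)]]
  have "p v - q v = 0"
  proof (rule gkm_vanish[of "\<lambda>v. p v - q v" "\<l> w"])
    show "gkm_class \<Delta> \<sigma> (\<lambda>v. p v - q v)" using p q gkm_diff by blast
    show "homogeneous (2 * \<l> w) (p v - q v)" if "v \<in> W" for v
      using p q that homogeneous_diff by blast
    show "p v - q v = 0" if "v \<in> W" "\<l> v \<le> \<l> w" for v
      using p q that by (cases "v = w") auto
  qed
  then show "p v = q v" by simp
qed

text \<open>The sign is chosen so that \<open>dd i\<close> maps \<open>S\<^sub>w\<close> to \<open>S\<^bsub>w r\<^esub>\<close> at a descent. The quotient
  is only meaningful for classes, where the GKM condition makes the difference divisible.\<close>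

definition dd :: "'i \<Rightarrow> (('v \<Rightarrow> 'v) \<Rightarrow> 'i H) \<Rightarrow> ('v \<Rightarrow> 'v) \<Rightarrow> 'i H" where
  "dd i p v = (if v \<in> W then SOME q. p (v \<circ> root_refl (\<sigma> i)) - p v = \<h> (v (\<sigma> i)) * q else 0)"

lemma dd_mult:
  assumes "gkm_class \<Delta> \<sigma> p" "v \<in> W"
  shows "p (v \<circ> root_refl (\<sigma> i)) - p v = \<h> (v (\<sigma> i)) * dd i p v"
proof -
  have "\<h> (v (\<sigma> i)) dvd p v - p (root_refl (v (\<sigma> i)) \<circ> v)"
    by (rule gkm_dvd[OF assms weyl_root[OF assms(2) simple_root]])
  then have "\<h> (v (\<sigma> i)) dvd p (v \<circ> root_refl (\<sigma> i)) - p v"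
    unfolding weyl_comp_root_refl[OF assms(2)] by (metis dvd_minus_iff minus_diff_eq)
  then have "\<exists>q. p (v \<circ> root_refl (\<sigma> i)) - p v = \<h> (v (\<sigma> i)) * q" unfolding dvd_def .
  from someI_ex[OF this] show ?thesis using assms(2) unfolding dd_def by simp
qed

lemma weyl_comp_simple: "v \<in> W \<Longrightarrow> v \<circ> root_refl (\<sigma> i) \<in> W"
  using weyl_comp_refl_iff[OF simple_root] by blast

text \<open>Let x = \<open>v (\<sigma> i)\<close>. If \<beta> is x or -x, then r_\<beta> v = v r,
  and the quotient is unchanged because numerator and denominator both change sign. Otherwise the
  numerators at v and r_\<beta> v agree modulo \<beta>, as do the denominators x and r_\<beta> x,
  and coprimality of \<beta> and x allows x to be cancelled.\<close>

lemma gkm_dd: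
  assumes p: "gkm_class \<Delta> \<sigma> p"
  shows "gkm_class \<Delta> \<sigma> (dd i p)"
  unfolding gkm_class_def
proof (intro conjI allI ballI impI)
  fix v \<beta> assume v: "v \<in> W" and \<beta>: "\<beta> \<in> \<Delta>"
  define x where "x = v (\<sigma> i)"
  have x: "x \<in> \<Delta>" unfolding x_def by (rule weyl_root[OF v simple_root])
  let ?v' = "root_refl \<beta> \<circ> v" and ?r = "root_refl (\<sigma> i)"
  have v': "?v' \<in> W" by (rule weyl_refl[OF v \<beta>])
  have 1: "p (v \<circ> ?r) - p v = \<h> x * dd i p v" unfolding x_def by (rule dd_mult[OF p v])
  have 2: "p (?v' \<circ> ?r) - p ?v' = \<h> (root_refl \<beta> x) * dd i p ?v'"
    using dd_mult[OF p v', of i] by (simp add: x_def)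
  show "\<h> \<beta> dvd dd i p v - dd i p ?v'"
  proof (cases "x = \<beta> \<or> x = - \<beta>")
    case True
    then have same: "root_refl x = root_refl \<beta>" using root_refl_uminus by metis
    have vr: "v \<circ> ?r = ?v'" unfolding weyl_comp_root_refl[OF v] x_def[symmetric] same ..
    have vrr: "?v' \<circ> ?r = v" unfolding vr[symmetric] comp_assoc root_refl_comp_self by (rule comp_id)
    have "root_refl \<beta> x = - x" unfolding same[symmetric] by (rule root_refl_self[OF root_nonzero[OF x]])
    then have "p v - p ?v' = - \<h> x * dd i p ?v'" using 2 unfolding vrr by (simp add: root_H_uminus[OF x])
    then have "\<h> x * dd i p v = \<h> x * dd i p ?v'" using 1 unfolding vr by (simp add: algebra_simps)
    then have "dd i p v = dd i p ?v'" by (rule H_mult_cancel[OF _ root_H_nonzero[OF x]])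
    then show ?thesis by simp
  next
    case False
    have vr: "?v' \<circ> ?r = root_refl \<beta> \<circ> (v \<circ> ?r)" by (rule comp_assoc)
    have d1: "\<h> \<beta> dvd p (v \<circ> ?r) - p (?v' \<circ> ?r)"
      unfolding vr by (rule gkm_dvd[OF p weyl_comp_simple[OF v] \<beta>])
    have d2: "\<h> \<beta> dvd p v - p ?v'" by (rule gkm_dvd[OF p v \<beta>])
    have "\<h> x * (dd i p v - dd i p ?v')
        = (p (v \<circ> ?r) - p (?v' \<circ> ?r)) - (p v - p ?v') - \<h> \<beta> * (of_int (pairing x \<beta>) * dd i p ?v')"
      using 1 2 unfolding root_H_refl[OF x \<beta>] by (simp add: algebra_simps)
    then have "\<h> \<beta> dvd \<h> x * (dd i p v - dd i p ?v')"
      using d1 d2 by (metis dvd_diff dvd_triv_left)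
    then show ?thesis using roots_coprime[OF \<beta> x] False by blast
  qed
qed (simp add: dd_def)

lemma homogeneous_dd:
  assumes "gkm_class \<Delta> \<sigma> p" "\<And>v. v \<in> W \<Longrightarrow> homogeneous (2 * Suc d) (p v)" "v \<in> W"
  shows "homogeneous (2 * d) (dd i p v)"
proof (rule homogeneous_factor)
  have root: "v (\<sigma> i) \<in> \<Delta>" by (rule weyl_root[OF assms(3) simple_root])
  show "homogeneous 2 (\<h> (v (\<sigma> i)))" "\<h> (v (\<sigma> i)) \<noteq> 0"
    using homogeneous_root_H root_H_nonzero root by blast+
  have "homogeneous (2 * Suc d) (p (v \<circ> root_refl (\<sigma> i)) - p v)"
    using assms weyl_comp_simple homogeneous_diff by blast
  then show "homogeneous (2 + 2 * d) (\<h> (v (\<sigma> i)) * dd i p v)"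
    unfolding dd_mult[OF assms(1,3)] by simp
qed

lemma simple_refl_cancel: "v \<circ> root_refl (\<sigma> i) = w \<circ> root_refl (\<sigma> i) \<longleftrightarrow> v = w"
  by (metis comp_assoc comp_id root_refl_comp_self)

text \<open>The inverse of w r is r w^-1, and r preserves the sign of w^-1 \<beta> unless that root
  is \<open>\<sigma> i\<close> or its negative. The first case is the new inversion; the second is
  excluded for positive \<beta> because \<open>w (\<sigma> i)\<close> is positive.\<close>

lemma inversions_comp_simple:
  assumes "w \<in> W" "w (\<sigma> i) \<in> \<Phi>"
  shows "inversions (w \<circ> root_refl (\<sigma> i)) = insert (w (\<sigma> i)) (inversions w)"
    and "w (\<sigma> i) \<notin> inversions w"
proof -
  note iw = weyl_inv[OF assms(1)]
  show "w (\<sigma> i) \<notin> inversions w"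
    using not_pos_and_neg[OF simple_pos] by (simp add: inversions_def iw)
  have inv: "inv (w \<circ> root_refl (\<sigma> i)) = root_refl (\<sigma> i) \<circ> inv w"
    by (rule inv_unique_comp) (simp_all add: fun_eq_iff iw)
  show "inversions (w \<circ> root_refl (\<sigma> i)) = insert (w (\<sigma> i)) (inversions w)"
  proof (intro set_eqI)
    fix \<beta>
    show "\<beta> \<in> inversions (w \<circ> root_refl (\<sigma> i)) \<longleftrightarrow> \<beta> \<in> insert (w (\<sigma> i)) (inversions w)"
    proof (cases "\<beta> \<in> \<Phi>")
      case False
      then show ?thesis using assms(2) inversions_subset by blast
    next
      case True
      define y where "y = inv w \<beta>"
      have \<beta>: "\<beta> = w y" unfolding y_def iw ..
      have root: "y \<in> \<Delta>" unfolding y_def by (rule weyl_root[OF iw(1) pos_root_root[OF True]])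
      have mem: "\<beta> \<in> inversions (w \<circ> root_refl (\<sigma> i)) \<longleftrightarrow> - root_refl (\<sigma> i) y \<in> \<Phi>"
          "\<beta> \<in> inversions w \<longleftrightarrow> - y \<in> \<Phi>"
        unfolding inversions_def inv y_def using True by auto
      have neg: "- root_refl (\<sigma> i) y = root_refl (\<sigma> i) (- y)"
        using linear_neg[OF linear_root_refl] by metis
      show ?thesis
      proof (cases "y = \<sigma> i")
        case True
        then have "- root_refl (\<sigma> i) y \<in> \<Phi>" using simple_pos by (simp add: root_refl_self)
        then show ?thesis using mem True \<beta> by blast
      next
        case False
        have "y \<noteq> - \<sigma> i"
        proof
          assume "y = - \<sigma> i"
          then have "- w (\<sigma> i) \<in> \<Phi>" using \<beta> True weyl_uminus[OF assms(1)] by metis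
          then show False using not_pos_and_neg[OF assms(2)] by blast
        qed
        then have "- y \<noteq> \<sigma> i" by (metis minus_minus)
        then have "- y \<in> \<Phi> \<Longrightarrow> - root_refl (\<sigma> i) y \<in> \<Phi>" unfolding neg using simple_refl_pos by blast
        moreover have "- y \<in> \<Phi>" if "- root_refl (\<sigma> i) y \<in> \<Phi>"
        proof -
          have "- root_refl (\<sigma> i) y \<noteq> \<sigma> i"
          proof
            assume "- root_refl (\<sigma> i) y = \<sigma> i"
            then have "- y = root_refl (\<sigma> i) (\<sigma> i)" unfolding neg by (metis root_refl_involutive)
            then show False using False by (simp add: root_refl_self)
          qed
          then have "root_refl (\<sigma> i) (- root_refl (\<sigma> i) y) \<in> \<Phi>" using simple_refl_pos that by blast
          then show ?thesis unfolding neg by simp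
        qed
        moreover have "\<beta> \<noteq> w (\<sigma> i)" using False iw(3) y_def by metis
        ultimately show ?thesis using mem by blast
      qed
    qed
  qed
qed

text \<open>For v other than w of length at most l(w), the numerator vanishes: v r has length at
  most l(w) + 1 and differs from w r. At w only the value at w r remains, and dividing by
  \<open>w (\<sigma> i)\<close> removes exactly the additional inversion.\<close>

lemma is_schubert_dd:
  assumes w: "w \<in> W" "w (\<sigma> i) \<in> \<Phi>" and p: "is_schubert \<Delta> \<sigma> (w \<circ> root_refl (\<sigma> i)) p"
  shows "is_schubert \<Delta> \<sigma> w (dd i p)"
proof -
  let ?r = "root_refl (\<sigma> i)"
  have wr: "w \<circ> ?r \<in> W" by (rule weyl_comp_simple[OF w(1)])
  have len: "\<l> (w \<circ> ?r) = Suc (\<l> w)" by (rule len_comp_simple[OF w])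
  note p = p[unfolded is_schubert_iff[OF wr] len]
  have gkm: "gkm_class \<Delta> \<sigma> p" using p by blast
  have p0: "p v = 0" if "v \<in> W" "\<l> v \<le> Suc (\<l> w)" "v \<noteq> w \<circ> ?r" for v using p that by blast
  have root: "w (\<sigma> i) \<in> \<Delta>" using w pos_root_root by blast
  show ?thesis unfolding is_schubert_iff[OF w(1)]
  proof (intro conjI ballI impI)
    show "gkm_class \<Delta> \<sigma> (dd i p)" by (rule gkm_dd[OF gkm])
    show "homogeneous (2 * \<l> w) (dd i p v)" if "v \<in> W" for v
      by (rule homogeneous_dd[OF gkm _ that]) (use p in blast)
    show "dd i p v = 0" if v: "v \<in> W" and lv: "\<l> v \<le> \<l> w \<and> v \<noteq> w" for v
    proof -
      have "p v = 0" by (rule p0[OF v]) (use lv len in auto)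
      moreover have "p (v \<circ> ?r) = 0"
        by (rule p0[OF weyl_comp_simple[OF v]])
          (use lv len_comp_simple_le[OF v, of i] simple_refl_cancel in auto)
      ultimately have "\<h> (v (\<sigma> i)) * dd i p v = 0" using dd_mult[OF gkm v, of i] by simp
      then show ?thesis using H_no_zero_divisors root_H_nonzero[OF weyl_root[OF v simple_root]] by blast
    qed
    have "p w = 0" by (rule p0[OF w(1)]) (use len in auto)
    moreover have "p (w \<circ> ?r) = \<h> (w (\<sigma> i)) * prod \<h> (inversions w)"
      using p inversions_comp_simple[OF w] finite_inversions by simp
    ultimately have "\<h> (w (\<sigma> i)) * dd i p w = \<h> (w (\<sigma> i)) * prod \<h> (inversions w)"
      using dd_mult[OF gkm w(1), of i] by simp
    then show "dd i p w = prod \<h> (inversions w)" by (rule H_mult_cancel[OF _ root_H_nonzero[OF root]])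
  qed
qed

text \<open>The class of a point, supported at the longest element: up to sign every root divides
  the product of all positive roots, which gives all GKM conditions.\<close>

lemma is_schubert_top:
  assumes w: "w \<in> W" "inversions w = \<Phi>"
  shows "is_schubert \<Delta> \<sigma> w (\<lambda>v. if v = w then prod \<h> \<Phi> else 0)"
  unfolding is_schubert_iff[OF w(1)]
proof (intro conjI ballI impI)
  let ?p = "\<lambda>v. if v = w then prod \<h> \<Phi> else 0"
  show "gkm_class \<Delta> \<sigma> ?p" unfolding gkm_class_def
  proof (intro conjI allI ballI impI)
    fix v \<beta> assume \<beta>: "\<beta> \<in> \<Delta>"
    have "\<h> \<beta> dvd prod \<h> \<Phi>"
    proof (cases "\<beta> \<in> \<Phi>")
      case True
      then show ?thesis by (rule dvd_prodI[OF finite_pos_roots])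
    next
      case False
      then have "\<h> (- \<beta>) dvd prod \<h> \<Phi>" using pos_or_neg[OF \<beta>] dvd_prodI[OF finite_pos_roots] by blast
      then show ?thesis by (simp add: root_H_uminus[OF \<beta>])
    qed
    then show "\<h> \<beta> dvd ?p v - ?p (root_refl \<beta> \<circ> v)" by auto
  qed (use w in auto)
  show "homogeneous (2 * \<l> w) (?p v)" for v
    using homogeneous_pos_roots_prod[of \<Phi>] len_eq_card_inversions[OF w(1)] w(2) by simp
qed (use w(2) in auto)

text \<open>Downward induction from the longest element: while some simple root stays positive under
  w, the element w r is longer and \<open>dd\<close> sends its class to one for w. The number of
  positive roots bounds the length.\<close>

lemma schubert_exists: "w \<in> W \<Longrightarrow> \<exists>p. is_schubert \<Delta> \<sigma> w p"
proof (induction "card \<Phi> - \<l> w" arbitrary: w rule: less_induct)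
  case less
  show ?case
  proof (cases "\<exists>i. w (\<sigma> i) \<in> \<Phi>")
    case True
    then obtain i where i: "w (\<sigma> i) \<in> \<Phi>" by blast
    let ?w' = "w \<circ> root_refl (\<sigma> i)"
    have w': "?w' \<in> W" by (rule weyl_comp_simple[OF less.prems])
    have "\<l> ?w' \<le> card \<Phi>"
      unfolding len_eq_card_inversions[OF w'] by (rule card_mono[OF finite_pos_roots inversions_subset])
    then have "card \<Phi> - \<l> ?w' < card \<Phi> - \<l> w" using len_comp_simple[OF less.prems i] by linarith
    then obtain p where "is_schubert \<Delta> \<sigma> ?w' p" using less.hyps w' by blast
    then show ?thesis using is_schubert_dd[OF less.prems i] by blast
  next
    case False
    then show ?thesis using is_schubert_top[OF less.prems inversions_top[OF less.prems]] by blast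
  qed
qed

lemma schubert_is_schubert:
  assumes "w \<in> W"
  shows "is_schubert \<Delta> \<sigma> w (schubert \<Delta> \<sigma> w)"
proof -
  obtain p where p: "is_schubert \<Delta> \<sigma> w p" using schubert_exists[OF assms] by blast
  show ?thesis
    unfolding schubert_def by (rule theI[of "is_schubert \<Delta> \<sigma> w", OF p]) (rule schubert_unique[OF assms _ p])
qed

subsection \<open>The right action of simple reflections\<close>

abbreviation S :: "('v \<Rightarrow> 'v) \<Rightarrow> ('v \<Rightarrow> 'v) \<Rightarrow> 'i H" where "S \<equiv> schubert \<Delta> \<sigma>"

lemma
  assumes "w \<in> W"
  shows schubert_gkm: "gkm_class \<Delta> \<sigma> (S w)"
    and schubert_homogeneous: "v \<in> W \<Longrightarrow> homogeneous (2 * \<l> w) (S w v)"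
    and schubert_eq_0: "v \<in> W \<Longrightarrow> \<l> v \<le> \<l> w \<Longrightarrow> v \<noteq> w \<Longrightarrow> S w v = 0"
    and schubert_self: "S w w = prod \<h> (inversions w)"
  using schubert_is_schubert[OF assms, unfolded is_schubert_iff[OF assms]] by blast+

lemma schubert_outside: "w \<in> W \<Longrightarrow> v \<notin> W \<Longrightarrow> S w v = 0"
  by (rule gkm_outside[OF schubert_gkm])

section \<open>Values of Schubert classes at covers\<close>

lemma invlist_roots: "set (invlist \<sigma> is) \<subseteq> \<Delta>"
  by (induction "is") (auto simp: simple_root root_refl_root)

lemma root_H_refl_dvd: "\<alpha> \<in> \<Delta> \<Longrightarrow> \<beta> \<in> \<Delta> \<Longrightarrow> \<h> \<beta> dvd \<h> (root_refl \<beta> \<alpha>) - \<h> \<alpha>"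
  by (simp add: root_H_refl)

text \<open>In a reduced word of \<open>v\<close>, deleting a letter with reflection \<open>r\<^sub>\<gamma>\<close> leaves the inversions
  before that letter unchanged and applies \<open>r\<^sub>\<gamma>\<close> to those after it.\<close>

lemma inversions_prod_cong:
  assumes u: "u \<in> W" and \<gamma>: "\<gamma> \<in> \<Phi>" and len: "\<l> (root_refl \<gamma> \<circ> u) = Suc (\<l> u)"
  shows "\<h> \<gamma> dvd prod \<h> (inversions (root_refl \<gamma> \<circ> u) - {\<gamma>}) - prod \<h> (inversions u)"
proof -
  let ?v = "root_refl \<gamma> \<circ> u"
  have root: "\<gamma> \<in> \<Delta>" by (rule pos_root_root[OF \<gamma>])
  have v: "?v \<in> W" by (rule weyl_refl[OF u root])
  have uv: "root_refl \<gamma> \<circ> ?v = u" unfolding comp_assoc[symmetric] root_refl_comp_self by (rule id_comp)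
  have inv: "\<gamma> \<in> inversions ?v" unfolding inversion_iff_len[OF v \<gamma>] uv len by simp
  obtain "is" where "is": "?v = word \<sigma> is" "length is = \<l> ?v" using reduced_word[OF v] by blast
  then obtain xs j ys where split: "is = xs @ j # ys" "\<gamma> = word \<sigma> xs (\<sigma> j)"
    using exchange inv by metis
  have u_word: "u = word \<sigma> (xs @ ys)"
    using refl_word_deletion[of xs j ys] uv "is"(1) split by metis
  have red_v: "\<l> (word \<sigma> is) = length is" using "is" by metis
  have red_u: "\<l> (word \<sigma> (xs @ ys)) = length (xs @ ys)"
    using "is"(2) len split(1) unfolding u_word[symmetric] by simp
  let ?a = "prod_list (map \<h> (invlist \<sigma> xs))"
    and ?f = "\<lambda>\<delta>. \<h> (root_refl \<gamma> (word \<sigma> xs \<delta>))" and ?g = "\<lambda>\<delta>. \<h> (word \<sigma> xs \<delta>)"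
  have refl: "word \<sigma> xs (root_refl (\<sigma> j) \<delta>) = root_refl \<gamma> (word \<sigma> xs \<delta>)" for \<delta>
    using fun_cong[OF orthogonal_comp_root_refl[OF orthogonal_word[of \<sigma> xs], of "\<sigma> j"], of \<delta>] split(2)
    by simp
  have "prod \<h> (inversions ?v) = prod_list (map \<h> (invlist \<sigma> is))"
    using reduced_inversions[OF red_v] unfolding "is"(1) by (metis prod.distinct_set_conv_list)
  \<comment> \<open>The entry of \<open>invlist\<close> at the letter \<open>j\<close> is \<gamma>
    itself; it is split off in order to be cancelled.\<close>
  also have "\<dots> = \<h> \<gamma> * (?a * prod_list (map ?f (invlist \<sigma> ys)))"
    unfolding split(1) invlist_append by (simp add: o_def refl flip: split(2))
  finally have "\<h> \<gamma> * prod \<h> (inversions ?v - {\<gamma>}) = \<h> \<gamma> * (?a * prod_list (map ?f (invlist \<sigma> ys)))"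
    unfolding prod.remove[OF finite_inversions inv] .
  then have Q: "prod \<h> (inversions ?v - {\<gamma>}) = ?a * prod_list (map ?f (invlist \<sigma> ys))"
    by (rule H_mult_cancel[OF _ root_H_nonzero[OF root]])
  have "prod \<h> (inversions u) = prod_list (map \<h> (invlist \<sigma> (xs @ ys)))"
    using reduced_inversions[OF red_u] unfolding u_word by (metis prod.distinct_set_conv_list)
  also have "\<dots> = ?a * prod_list (map ?g (invlist \<sigma> ys))"
    unfolding invlist_append by (simp add: o_def)
  finally have P: "prod \<h> (inversions u) = ?a * prod_list (map ?g (invlist \<sigma> ys))" .
  have "\<h> \<gamma> dvd prod_list (map ?f (invlist \<sigma> ys)) - prod_list (map ?g (invlist \<sigma> ys))"
  proof (rule prod_list_diff_dvd)
    fix \<delta> assume "\<delta> \<in> set (invlist \<sigma> ys)"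
    then have "word \<sigma> xs \<delta> \<in> \<Delta>" using invlist_roots weyl_root[OF word_weyl] by blast
    then show "\<h> \<gamma> dvd ?f \<delta> - ?g \<delta>" by (rule root_H_refl_dvd[OF _ root])
  qed
  then show ?thesis unfolding P Q right_diff_distrib[symmetric] by (rule dvd_mult)
qed

text \<open>If \<delta> is an inversion of the cover v other than \<gamma>, then r_\<delta> v has
  length at most l(u) and is not u, so S_u vanishes there. These l(u) roots therefore divide S_u at
  v, which has the same degree, and the quotient \<open>g\<close> is an integer. Both
  \<open>S u v\<close> and the product of these roots are congruent to \<open>S u u\<close> modulo
  \<gamma>, which gives \<open>g\<close> = 1.\<close>

lemma schubert_at_cover:
  assumes u: "u \<in> W" and \<gamma>: "\<gamma> \<in> \<Phi>" and len: "\<l> (root_refl \<gamma> \<circ> u) = Suc (\<l> u)"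
  shows "prod \<h> (inversions (root_refl \<gamma> \<circ> u)) = \<h> \<gamma> * S u (root_refl \<gamma> \<circ> u)"
proof -
  define v where "v = root_refl \<gamma> \<circ> u"
  have root: "\<gamma> \<in> \<Delta>" by (rule pos_root_root[OF \<gamma>])
  have v: "v \<in> W" unfolding v_def by (rule weyl_refl[OF u root])
  have uv: "root_refl \<gamma> \<circ> v = u"
    unfolding v_def comp_assoc[symmetric] root_refl_comp_self by (rule id_comp)
  have lv: "\<l> v = Suc (\<l> u)" unfolding v_def by (rule len)
  have inv: "\<gamma> \<in> inversions v" unfolding inversion_iff_len[OF v \<gamma>] uv lv by simp
  define A where "A = inversions v - {\<gamma>}"
  have A: "A \<subseteq> \<Phi>" unfolding A_def using inversions_subset by blast
  have card_A: "card A = \<l> u"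
    using len_eq_card_inversions[OF v] lv inv finite_inversions unfolding A_def by simp
  have "prod \<h> A dvd S u v"
  proof (rule pos_roots_prod_dvd[OF A])
    fix \<delta> assume \<delta>: "\<delta> \<in> A"
    then have \<delta>': "\<delta> \<in> inversions v" "\<delta> \<noteq> \<gamma>" "\<delta> \<in> \<Phi>" using A unfolding A_def by auto
    have root': "\<delta> \<in> \<Delta>" by (rule pos_root_root[OF \<delta>'(3)])
    have "root_refl \<delta> \<circ> v \<noteq> u"
    proof
      assume "root_refl \<delta> \<circ> v = u"
      then have "root_refl \<delta> \<circ> v = root_refl \<gamma> \<circ> v" unfolding uv .
      from root_refl_eq_iff[OF \<delta>'(3) \<gamma> weyl_cancel_right[OF v this]] \<delta>'(2) show False by blast
    qed
    moreover have "\<l> (root_refl \<delta> \<circ> v) \<le> \<l> u" using inversion_len_less[OF v \<delta>'(1)] lv by simp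
    ultimately have "S u (root_refl \<delta> \<circ> v) = 0" using schubert_eq_0[OF u weyl_refl[OF v root']] by blast
    then show "\<h> \<delta> dvd S u v" using gkm_dvd[OF schubert_gkm[OF u] v root'] by simp
  qed
  then obtain g where g: "S u v = prod \<h> A * g" by blast
  have "homogeneous (2 * card A + 0) (prod \<h> A * g)"
    using schubert_homogeneous[OF u v] unfolding g card_A by simp
  then have "homogeneous 0 g"
    by (rule homogeneous_factor[OF homogeneous_pos_roots_prod[OF A] pos_roots_prod_nonzero[OF A]])
  then have deg: "homogeneous (2 * 0) (g - 1)" by (simp add: homogeneous_diff homogeneous_1)
  have d1: "\<h> \<gamma> dvd S u v - prod \<h> (inversions u)"
    using gkm_dvd[OF schubert_gkm[OF u] v root] unfolding uv schubert_self[OF u] .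
  have d2: "\<h> \<gamma> dvd prod \<h> A - prod \<h> (inversions u)"
    using inversions_prod_cong[OF u \<gamma> len] unfolding A_def v_def .
  have "prod \<h> A * (g - 1) = (S u v - prod \<h> (inversions u)) - (prod \<h> A - prod \<h> (inversions u))"
    unfolding g by (simp add: algebra_simps)
  then have "\<h> \<gamma> dvd prod \<h> A * (g - 1)" using dvd_diff[OF d1 d2] by simp
  \<comment> \<open>No root in \<open>A\<close> equals \<gamma>, so the product over
    \<open>A\<close> can be cancelled modulo \<gamma>.\<close>
  then have "\<h> \<gamma> dvd g - 1"
  proof (rule coprime_strip_prod[rotated 2])
    show "finite A" unfolding A_def using finite_inversions by blast
    show "\<h> \<gamma> dvd h" if "y \<in> A" "\<h> \<gamma> dvd \<h> y * h" for y h
    proof (rule pos_roots_coprime[OF \<gamma> _ _ that(2)])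
      show "y \<in> \<Phi>" "\<gamma> \<noteq> y" using that(1) A unfolding A_def by auto
    qed
  qed
  \<comment> \<open>The degree argument with \<open>d\<close> = 0: a constant divisible by a root is
    zero.\<close>
  then have "g - 1 = 0"
    by (intro pos_roots_dvd_eq_0[of "{\<gamma>}", OF _ _ deg]) (use \<gamma> in auto)
  then have "S u v = prod \<h> A" using g by simp
  then show ?thesis
    using prod.remove[OF finite_inversions inv, of \<h>] unfolding A_def v_def by simp
qed

lemma covers_iff_len:
  assumes "u \<in> W" "\<beta> \<in> \<Delta>"
  shows "covers \<Delta> \<sigma> (u \<circ> root_refl \<beta>) u \<longleftrightarrow> \<l> (u \<circ> root_refl \<beta>) = Suc (\<l> u)"
  unfolding covers_def weyl_comp_root_refl[OF assms(1)]
    bruhat_less_root_refl_iff[OF assms(1) weyl_root[OF assms]] by auto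

lemma bruhat_less_simple_iff:
  assumes "w \<in> W"
  shows "bruhat_less \<Delta> \<sigma> w (w \<circ> root_refl (\<sigma> i)) \<longleftrightarrow> w (\<sigma> i) \<in> \<Phi>"
proof -
  have "bruhat_less \<Delta> \<sigma> w (w \<circ> root_refl (\<sigma> i)) \<longleftrightarrow> \<l> w < \<l> (w \<circ> root_refl (\<sigma> i))"
    unfolding weyl_comp_root_refl[OF assms]
    by (rule bruhat_less_root_refl_iff[OF assms weyl_root[OF assms simple_root]])
  then show ?thesis using right_mult_len[OF assms simple_pos[of i]] by fastforce
qed

text \<open>Both sides are classes of degree \<open>l(u) + 1\<close> in \<open>v\<close>, so it suffices to compare them at
  elements of length at most \<open>l(u) + 1\<close>.\<close>

lemma schubert_chevalley:
  assumes u: "u \<in> W" and v: "v \<in> W"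
  shows "(\<h> (v (\<sigma> i)) - \<h> (u (\<sigma> i))) * S u v =
    - (\<Sum>\<beta> | \<beta> \<in> \<Phi> \<and> covers \<Delta> \<sigma> (u \<circ> root_refl \<beta>) u.
        of_int (pairing (\<sigma> i) \<beta>) * S (u \<circ> root_refl \<beta>) v)"
proof -
  define C where "C = {\<beta> \<in> \<Phi>. covers \<Delta> \<sigma> (u \<circ> root_refl \<beta>) u}"
  have fin_C: "finite C" unfolding C_def using finite_pos_roots by simp
  have C: "\<beta> \<in> \<Phi>" "\<beta> \<in> \<Delta>" "u \<circ> root_refl \<beta> \<in> W" "\<l> (u \<circ> root_refl \<beta>) = Suc (\<l> u)" if "\<beta> \<in> C" for \<beta>
    using that covers_iff_len[OF u] pos_root_root weyl_comp_refl_iff u unfolding C_def by blast+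
  define T where "T v = (\<Sum>\<beta>\<in>C. of_int (pairing (\<sigma> i) \<beta>) * S (u \<circ> root_refl \<beta>) v)" for v
  define q where "q v = (\<h> (v (\<sigma> i)) - \<h> (u (\<sigma> i))) * S u v + T v" for v
  have root: "x (\<sigma> i) \<in> \<Delta>" if "x \<in> W" for x by (rule weyl_root[OF that simple_root])
  have "q v = 0"
  proof (rule gkm_vanish[of q "Suc (\<l> u)"])
    show "gkm_class \<Delta> \<sigma> q" unfolding gkm_class_def
    proof (intro conjI allI ballI impI)
      fix x \<beta> assume x: "x \<in> W" and \<beta>: "\<beta> \<in> \<Delta>"
      let ?y = "root_refl \<beta> \<circ> x"
      have "T x - T ?y = (\<Sum>\<delta>\<in>C. of_int (pairing (\<sigma> i) \<delta>) *
          (S (u \<circ> root_refl \<delta>) x - S (u \<circ> root_refl \<delta>) ?y))"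
        unfolding T_def by (simp add: sum_subtractf right_diff_distrib)
      moreover have "\<h> \<beta> dvd \<dots>"
        by (intro dvd_sum dvd_mult gkm_dvd[OF schubert_gkm x \<beta>] C)
      ultimately have d1: "\<h> \<beta> dvd T x - T ?y" by simp
      have d2: "\<h> \<beta> dvd \<h> (root_refl \<beta> (x (\<sigma> i))) - \<h> (x (\<sigma> i))"
        by (rule root_H_refl_dvd[OF root[OF x] \<beta>])
      have d3: "\<h> \<beta> dvd S u x - S u ?y" by (rule gkm_dvd[OF schubert_gkm[OF u] x \<beta>])
      \<comment> \<open>A product rule for differences: each of the three terms contains a change
        along r_\<beta>, which is a multiple of \<beta>.\<close>
      have "q x - q ?y = (\<h> (x (\<sigma> i)) - \<h> (u (\<sigma> i))) * (S u x - S u ?y)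
          - (\<h> (root_refl \<beta> (x (\<sigma> i))) - \<h> (x (\<sigma> i))) * S u ?y + (T x - T ?y)"
        unfolding q_def by (simp add: algebra_simps)
      then show "\<h> \<beta> dvd q x - q ?y"
        by (simp only:) (intro dvd_add dvd_diff dvd_mult[OF d3] dvd_mult2[OF d2] d1)
    next
      fix x assume "x \<notin> W"
      then show "q x = 0" using C(3) by (simp add: q_def T_def schubert_outside u)
    qed
  next
    fix x assume x: "x \<in> W"
    have "homogeneous (2 + 2 * \<l> u) ((\<h> (x (\<sigma> i)) - \<h> (u (\<sigma> i))) * S u x)"
      by (intro homogeneous_mult homogeneous_diff homogeneous_root_H root x u schubert_homogeneous)
    moreover have "homogeneous (2 * Suc (\<l> u)) (T x)" unfolding T_def
    proof (intro homogeneous_sum homogeneous_of_int_mult)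
      fix \<beta> assume "\<beta> \<in> C"
      from schubert_homogeneous[OF C(3)[OF this] x] C(4)[OF this]
      show "homogeneous (2 * Suc (\<l> u)) (S (u \<circ> root_refl \<beta>) x)" by simp
    qed
    ultimately show "homogeneous (2 * Suc (\<l> u)) (q x)"
      unfolding q_def using homogeneous_add by simp
  next
    fix x assume x: "x \<in> W" and lx: "\<l> x \<le> Suc (\<l> u)"
    have zero: "S (u \<circ> root_refl \<beta>) x = 0" if "\<beta> \<in> C" "x \<noteq> u \<circ> root_refl \<beta>" for \<beta>
      using schubert_eq_0[OF C(3)[OF that(1)] x] lx C(4)[OF that(1)] that(2) by simp
    show "q x = 0"
    proof (cases "\<exists>\<gamma>\<in>C. x = u \<circ> root_refl \<gamma>")
      case True
      then obtain \<gamma> where \<gamma>: "\<gamma> \<in> C" and x_eq: "x = u \<circ> root_refl \<gamma>" by blast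
      note \<gamma>' = C[OF \<gamma>]
      have other: "u \<circ> root_refl \<beta> \<noteq> x" if "\<beta> \<in> C" "\<beta> \<noteq> \<gamma>" for \<beta>
      proof
        assume "u \<circ> root_refl \<beta> = x"
        then have eq: "u \<circ> root_refl \<beta> = u \<circ> root_refl \<gamma>" unfolding x_eq .
        have "root_refl \<beta> y = root_refl \<gamma> y" for y
          using fun_cong[OF eq, of y] weyl_inv(3)[OF u] unfolding o_apply by metis
        then have "root_refl \<beta> = root_refl \<gamma>" by blast
        then show False using root_refl_eq_iff[OF C(1)[OF that(1)] \<gamma>'(1)] that(2) by blast
      qed
      \<comment> \<open>Distinct positive roots give distinct covers, so only the summand of
        \<gamma> survives at x.\<close>
      have "T x = (\<Sum>\<beta>\<in>{\<gamma>}. of_int (pairing (\<sigma> i) \<beta>) * S (u \<circ> root_refl \<beta>) x)"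
        unfolding T_def
      proof (rule sum.mono_neutral_right[OF fin_C])
        show "\<forall>\<beta>\<in>C - {\<gamma>}. of_int (pairing (\<sigma> i) \<beta>) * S (u \<circ> root_refl \<beta>) x = 0"
          using zero other by fastforce
      qed (use \<gamma> in simp)
      then have T: "T x = of_int (pairing (\<sigma> i) \<gamma>) * prod \<h> (inversions x)"
        unfolding x_eq using schubert_self[OF \<gamma>'(3)] by simp
      define \<delta> where "\<delta> = u \<gamma>"
      have x_eq': "x = root_refl \<delta> \<circ> u" unfolding x_eq \<delta>_def by (rule weyl_comp_root_refl[OF u])
      have \<delta>: "\<delta> \<in> \<Phi>"
        using right_mult_len(2)[OF u \<gamma>'(1)] \<gamma>'(4) unfolding \<delta>_def by fastforce
      have prod_x: "prod \<h> (inversions x) = \<h> \<delta> * S u x"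
        unfolding x_eq' by (rule schubert_at_cover[OF u \<delta>]) (use \<gamma>'(4) x_eq x_eq' in metis)
      \<comment> \<open>The origin of the coefficients: from u to its cover the image of the simple
        root moves by -\<open>pairing (\<sigma> i) \<gamma>\<close> times \<delta>, and \<delta>
        times \<open>S u x\<close> is the diagonal value in \<open>T x\<close>, so the two terms
        cancel.\<close>
      have "x (\<sigma> i) = u (\<sigma> i) - real_of_int (pairing (\<sigma> i) \<gamma>) *\<^sub>R \<delta>"
        unfolding x_eq \<delta>_def o_apply root_refl_pairing[OF simple_root \<gamma>'(2)]
        by (simp only: linear_diff[OF weyl_linear[OF u]] linear_cmul[OF weyl_linear[OF u]])
      then have hx: "\<h> (x (\<sigma> i)) = \<h> (u (\<sigma> i)) - of_int (pairing (\<sigma> i) \<gamma>) * \<h> \<delta>"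
        using lattice_diff_scale(2)[OF root_lattice[OF root[OF u]] root_lattice[OF pos_root_root[OF \<delta>]]] by simp
      show ?thesis unfolding q_def T prod_x hx by (simp add: algebra_simps)
    next
      case False
      then have T: "T x = 0" unfolding T_def using zero by (intro sum.neutral) fastforce
      show ?thesis
      proof (cases "\<l> x \<le> \<l> u")
        case True
        then have "x = u \<or> S u x = 0" using schubert_eq_0[OF u x] by blast
        \<comment> \<open>At x = u it is the difference of the two root forms that vanishes.\<close>
        then show ?thesis unfolding q_def T by auto
      next
        case gt: False
        then have lx': "\<l> x = Suc (\<l> u)" using lx by simp
        \<comment> \<open>Since x does not cover u, no inversion of x reflects x to u. All l(u) + 1
          inversions then divide a value of polynomial degree l(u).\<close>
        have "S u x = 0"
        proof (rule pos_roots_dvd_eq_0[OF inversions_subset _ schubert_homogeneous[OF u x]])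
          show "\<l> u < card (inversions x)" using gt unfolding len_eq_card_inversions[OF x] by simp
          fix \<delta> assume \<delta>: "\<delta> \<in> inversions x"
          have \<delta>': "\<delta> \<in> \<Phi>" "\<delta> \<in> \<Delta>" using \<delta> inversions_subset pos_root_root by blast+
          have "root_refl \<delta> \<circ> x \<noteq> u"
          proof
            assume "root_refl \<delta> \<circ> x = u"
            then have x_eq: "x = root_refl \<delta> \<circ> u"
              by (metis comp_assoc id_comp root_refl_comp_self)
            define \<gamma> where "\<gamma> = inv u \<delta>"
            have \<gamma>: "\<gamma> \<in> \<Delta>" unfolding \<gamma>_def by (rule weyl_root[OF weyl_inv(1)[OF u] \<delta>'(2)])
            have "u \<gamma> = \<delta>" unfolding \<gamma>_def by (rule weyl_inv(2)[OF u])
            then have x_eq': "x = u \<circ> root_refl \<gamma>" unfolding weyl_comp_root_refl[OF u] x_eq by simp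
            have cov: "covers \<Delta> \<sigma> (u \<circ> root_refl \<gamma>) u"
              using lx' covers_iff_len[OF u \<gamma>] unfolding x_eq'[symmetric] by blast
            show False
            proof (cases "\<gamma> \<in> \<Phi>")
              case True
              then show False using \<open>\<not> (\<exists>\<gamma>\<in>C. x = u \<circ> root_refl \<gamma>)\<close> cov x_eq' unfolding C_def by blast
            next
              case neg: False
              \<comment> \<open>\<open>C\<close> is indexed by positive roots; a negative \<gamma>
                is replaced by its negative, which has the same reflection.\<close>
              then have "- \<gamma> \<in> C" using cov pos_or_neg[OF \<gamma>] unfolding C_def mem_Collect_eq root_refl_uminus by blast
              moreover have "x = u \<circ> root_refl (- \<gamma>)" unfolding root_refl_uminus by (rule x_eq')
              ultimately show False using \<open>\<not> (\<exists>\<gamma>\<in>C. x = u \<circ> root_refl \<gamma>)\<close> by blast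
            qed
          qed
          moreover have "\<l> (root_refl \<delta> \<circ> x) \<le> \<l> u" using inversion_len_less[OF x \<delta>] lx' by simp
          ultimately have "S u (root_refl \<delta> \<circ> x) = 0"
            using schubert_eq_0[OF u weyl_refl[OF x \<delta>'(2)]] by blast
          then show "\<h> \<delta> dvd S u x" using gkm_dvd[OF schubert_gkm[OF u] x \<delta>'(2)] by simp
        qed
        then show ?thesis unfolding q_def T by simp
      qed
    qed
  qed
  then show ?thesis unfolding q_def T_def C_def by (simp add: eq_neg_iff_add_eq_0)
qed

text \<open>The divided difference has polynomial degree l(w) - 1 and vanishes up to that length:
  neither x nor x r can be w there, as x r = w would make x = w r, of length l(w) + 1.\<close>

lemma schubert_right_act_ascent:
  assumes w: "w \<in> W" "w (\<sigma> i) \<in> \<Phi>" and v: "v \<in> W"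
  shows "S w (v \<circ> root_refl (\<sigma> i)) = S w v"
proof (cases "\<l> w")
  \<comment> \<open>At length zero there is no degree left to lower; the difference is a constant
    divisible by a root, hence zero.\<close>
  case 0
  have root: "v (\<sigma> i) \<in> \<Delta>" by (rule weyl_root[OF v simple_root])
  have "\<h> (v (\<sigma> i)) dvd S w (v \<circ> root_refl (\<sigma> i)) - S w v"
    unfolding dd_mult[OF schubert_gkm[OF w(1)] v] by (rule dvd_triv_left)
  moreover have "homogeneous 0 (S w (v \<circ> root_refl (\<sigma> i)) - S w v)"
    using schubert_homogeneous[OF w(1)] v weyl_comp_simple[OF v] 0 by (auto intro!: homogeneous_diff)
  ultimately show ?thesis
    using homogeneous_dvd_eq_0[OF homogeneous_root_H[OF root] root_H_nonzero[OF root]] by fastforce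
next
  case (Suc d)
  have gkm: "gkm_class \<Delta> \<sigma> (S w)" by (rule schubert_gkm[OF w(1)])
  have "dd i (S w) v = 0"
  proof (rule gkm_vanish[of "dd i (S w)" d])
    show "gkm_class \<Delta> \<sigma> (dd i (S w))" by (rule gkm_dd[OF gkm])
    show "homogeneous (2 * d) (dd i (S w) x)" if "x \<in> W" for x
      by (rule homogeneous_dd[OF gkm _ that]) (use schubert_homogeneous[OF w(1)] Suc in simp)
    show "dd i (S w) x = 0" if x: "x \<in> W" and lx: "\<l> x \<le> d" for x
    proof -
      have xr: "x \<circ> root_refl (\<sigma> i) \<in> W" by (rule weyl_comp_simple[OF x])
      have lxr: "\<l> (x \<circ> root_refl (\<sigma> i)) \<le> \<l> w" using len_comp_simple_le[OF x, of i] lx Suc by simp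
      have "x \<circ> root_refl (\<sigma> i) \<noteq> w"
      proof
        assume "x \<circ> root_refl (\<sigma> i) = w"
        then have "x = w \<circ> root_refl (\<sigma> i)" by (metis comp_assoc comp_id root_refl_comp_self)
        then show False using len_comp_simple[OF w] lx Suc by simp
      qed
      then have "S w (x \<circ> root_refl (\<sigma> i)) = 0" using schubert_eq_0[OF w(1) xr lxr] by blast
      moreover have "S w x = 0" by (rule schubert_eq_0[OF w(1) x]) (use lx Suc in auto)
      ultimately have "\<h> (x (\<sigma> i)) * dd i (S w) x = 0" using dd_mult[OF gkm x, of i] by simp
      then show ?thesis using H_no_zero_divisors root_H_nonzero[OF weyl_root[OF x simple_root]] by blast
    qed
  qed
  then show ?thesis using dd_mult[OF gkm v, of i] by simp
qed

text \<open>In S_w + (v\<alpha>) S_u write v\<alpha> as u\<alpha> + (v\<alpha> - u\<alpha>). Since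
  u\<alpha> = -w\<alpha>, the first part is the term with w\<alpha>, and
  \<open>schubert_chevalley\<close> turns the second into the sum over covers.\<close>

lemma schubert_right_act_descent:
  assumes u: "u \<in> W" "u (\<sigma> i) \<in> \<Phi>" and v: "v \<in> W"
  defines "w \<equiv> u \<circ> root_refl (\<sigma> i)"
  shows "S w (v \<circ> root_refl (\<sigma> i)) = S w v - act_H \<sigma> w (\<h> (\<sigma> i)) * S u v
    - (\<Sum>\<beta> | \<beta> \<in> \<Phi> \<and> covers \<Delta> \<sigma> (u \<circ> root_refl \<beta>) u.
        of_int (pairing (\<sigma> i) \<beta>) * S (u \<circ> root_refl \<beta>) v)"
proof -
  have w: "w \<in> W" unfolding w_def by (rule weyl_comp_simple[OF u(1)])
  have "dd i (S w) = S u"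
    by (rule schubert_unique[OF u(1) is_schubert_dd[OF u] schubert_is_schubert[OF u(1)]])
      (use schubert_is_schubert[OF w] in \<open>simp only: w_def\<close>)
  then have eq: "S w (v \<circ> root_refl (\<sigma> i)) = S w v + \<h> (v (\<sigma> i)) * S u v"
    using dd_mult[OF schubert_gkm[OF w] v, of i] by (simp add: algebra_simps)
  have "act_H \<sigma> w (\<h> (\<sigma> i)) = \<h> (w (\<sigma> i))" by (rule act_H_root_H[OF w root_lattice[OF simple_root]])
  also have "w (\<sigma> i) = - u (\<sigma> i)" by (simp add: w_def root_refl_self weyl_uminus[OF u(1)])
  also have "\<h> (- u (\<sigma> i)) = - \<h> (u (\<sigma> i))" by (rule root_H_uminus[OF weyl_root[OF u(1) simple_root]])
  finally have act: "act_H \<sigma> w (\<h> (\<sigma> i)) = - \<h> (u (\<sigma> i))" .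
  show ?thesis unfolding eq act using schubert_chevalley[OF u(1) v, of i] by (simp add: algebra_simps)
qed

end

theorem mainTheorem2:
  fixes \<Delta> :: "'v::euclidean_space set"
    and \<sigma> :: "'i::finite \<Rightarrow> 'v"
    and \<alpha> :: 'v
    and w :: "'v \<Rightarrow> 'v"
  assumes "root_system \<Delta>"
    and "simple_system \<Delta> \<sigma>"
    and "\<alpha> \<in> range \<sigma>"
    and "w \<in> weyl \<Delta>"
  shows "(bruhat_less \<Delta> \<sigma> w (w \<circ> root_refl \<alpha>) \<longrightarrow>
            right_act (schubert \<Delta> \<sigma> w) \<alpha> = schubert \<Delta> \<sigma> w) \<and>
         (\<not> bruhat_less \<Delta> \<sigma> w (w \<circ> root_refl \<alpha>) \<longrightarrow>
            right_act (schubert \<Delta> \<sigma> w) \<alpha> =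
              (\<lambda>v. schubert \<Delta> \<sigma> w v
                 - act_H \<sigma> w (root_H \<sigma> \<alpha>) * schubert \<Delta> \<sigma> (w \<circ> root_refl \<alpha>) v
                 - (\<Sum>\<beta> | \<beta> \<in> pos_roots \<Delta> \<sigma> \<and>
                          covers \<Delta> \<sigma> (w \<circ> root_refl \<alpha> \<circ> root_refl \<beta>) (w \<circ> root_refl \<alpha>).
                      of_int (pairing \<alpha> \<beta>) *
                      schubert \<Delta> \<sigma> (w \<circ> root_refl \<alpha> \<circ> root_refl \<beta>) v)))"
proof -
  interpret based_root_system \<Delta> \<sigma> by unfold_locales fact+
  obtain i where \<alpha>: "\<alpha> = \<sigma> i" using assms(3) by blast
  note w = assms(4)
  let ?r = "root_refl (\<sigma> i)"
  show ?thesis unfolding \<alpha>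
  proof (intro conjI impI ext)
    fix v
    assume "bruhat_less \<Delta> \<sigma> w (w \<circ> ?r)"
    then have pos: "w (\<sigma> i) \<in> \<Phi>" unfolding bruhat_less_simple_iff[OF w] .
    show "right_act (S w) (\<sigma> i) v = S w v"
    proof (cases "v \<in> W")
      case True
      then show ?thesis unfolding right_act_def by (rule schubert_right_act_ascent[OF w pos])
    next
      \<comment> \<open>Classes are extended by 0 off the Weyl group, and v r lies outside it
        exactly when v does.\<close>
      case False
      then show ?thesis
        unfolding right_act_def using schubert_outside[OF w] weyl_comp_refl_iff[OF simple_root] by metis
    qed
  next
    fix v
    assume "\<not> bruhat_less \<Delta> \<sigma> w (w \<circ> ?r)"
    then have neg: "w (\<sigma> i) \<notin> \<Phi>" unfolding bruhat_less_simple_iff[OF w] .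
    \<comment> \<open>The descent is read from the shorter element, under which
      \<open>\<sigma> i\<close> stays positive.\<close>
    define u where "u = w \<circ> ?r"
    have u: "u \<in> W" unfolding u_def by (rule weyl_comp_simple[OF w])
    have w_eq: "w = u \<circ> ?r" unfolding u_def comp_assoc root_refl_comp_self by (rule comp_id[symmetric])
    have "u (\<sigma> i) = - w (\<sigma> i)" by (simp add: u_def root_refl_self weyl_uminus[OF w])
    then have pos: "u (\<sigma> i) \<in> \<Phi>" using neg pos_or_neg[OF weyl_root[OF w simple_root]] by metis
    show "right_act (S w) (\<sigma> i) v = S w v - act_H \<sigma> w (\<h> (\<sigma> i)) * S (w \<circ> ?r) v
        - (\<Sum>\<beta> | \<beta> \<in> \<Phi> \<and> covers \<Delta> \<sigma> (w \<circ> ?r \<circ> root_refl \<beta>) (w \<circ> ?r).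
            of_int (pairing (\<sigma> i) \<beta>) * S (w \<circ> ?r \<circ> root_refl \<beta>) v)"
      unfolding u_def[symmetric] right_act_def
    proof (cases "v \<in> W")
      case True
      show "S w (v \<circ> ?r) = S w v - act_H \<sigma> w (\<h> (\<sigma> i)) * S u v
          - (\<Sum>\<beta> | \<beta> \<in> \<Phi> \<and> covers \<Delta> \<sigma> (u \<circ> root_refl \<beta>) u.
              of_int (pairing (\<sigma> i) \<beta>) * S (u \<circ> root_refl \<beta>) v)"
        using schubert_right_act_descent[OF u pos True] unfolding w_eq[symmetric] .
    next
      case False
      have "v \<circ> ?r \<notin> W" using False weyl_comp_refl_iff[OF simple_root] by blast
      moreover have "S (u \<circ> root_refl \<beta>) v = 0" if "\<beta> \<in> \<Phi>" for \<beta>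
        using schubert_outside False weyl_comp_refl_iff[OF pos_root_root[OF that]] u by blast
      ultimately show "S w (v \<circ> ?r) = S w v - act_H \<sigma> w (\<h> (\<sigma> i)) * S u v
          - (\<Sum>\<beta> | \<beta> \<in> \<Phi> \<and> covers \<Delta> \<sigma> (u \<circ> root_refl \<beta>) u.
              of_int (pairing (\<sigma> i) \<beta>) * S (u \<circ> root_refl \<beta>) v)"
        using False by (simp add: schubert_outside w u)
    qed
  qed
qed

end
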